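(* Let $X$ and $Y$ be disjoint sets, each of cardinality at least two, and let $M \le \mathrm{Sym}(X)$ and $N \le \mathrm{Sym}(Y)$ be permutation groups that are both generated by point stabilisers, with at least one of $M$, $N$ nontrivial. Then the box product $M \boxtimes N$ is simple if and only if $M$ or $N$ is transitive.
   Context: A permutation group $G \le \mathrm{Sym}(V)$ is generated by point stabilisers if $G = \langle G_\alpha : \alpha \in V\rangle$. Let $T$ be the $(|X|,|Y|)$-biregular tree, with natural bipartition $VT = V_X \sqcup V_Y$, where vertices of $V_X$ have valency $|X|$ and vertices of $V_Y$ have valency $|Y|$. Arcs are ordered pairs of adjacent vertices; $A(v)$ (resp. $\overline{A}(v)$) denotes the set of arcs with origin (resp. terminus) $v$. A legal colouring is a map $c: AT \to X\cup Y$ such that $c|_{A(v)}$ is a bijection onto $X$ for $v\in V_X$, onto $Y$ for $v \in V_Y$, and $c$ is constant on $\overline{A}(v)$ for all $v$. $U_c(M,N)$ is the group of $g\in\mathrm{Aut}(T)$ with $gV_X=V_X$ such that $c|_{A(gv)}\circ g|_{A(v)}\circ (c|_{A(v)})^{-1}$ lies in $M$ for all $v\in V_X$ and in $N$ for all $v\in V_Y$. The box product $M\boxtimes N$ is the subgroup of $\mathrm{Sym}(V_Y)$ induced by $U_c(M,N)$ (independent of $c$ up to permutation isomorphism). *)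

theory Defs
  imports "HOL-Algebra.Algebra" "HOL-Library.Equipollence"
begin

text \<open>Permutation groups on a set S are subgroups of the symmetric group BijGroup S
  (elements: bijections of S, extensional, i.e. undefined outside S).\<close>

definition perm_group :: "'a set \<Rightarrow> ('a \<Rightarrow> 'a) set \<Rightarrow> bool" where
  "perm_group S G \<longleftrightarrow> subgroup G (BijGroup S)"

definition point_stabiliser :: "'a set \<Rightarrow> ('a \<Rightarrow> 'a) set \<Rightarrow> 'a \<Rightarrow> ('a \<Rightarrow> 'a) set" where
  "point_stabiliser S G \<alpha> = {g \<in> G. g \<alpha> = \<alpha>}"

definition gen_by_point_stabilisers :: "'a set \<Rightarrow> ('a \<Rightarrow> 'a) set \<Rightarrow> bool" where
  "gen_by_point_stabilisers S G \<longleftrightarrow>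
     G = generate (BijGroup S) (\<Union>\<alpha>\<in>S. point_stabiliser S G \<alpha>)"

definition perm_transitive :: "'a set \<Rightarrow> ('a \<Rightarrow> 'a) set \<Rightarrow> bool" where
  "perm_transitive S G \<longleftrightarrow> (\<forall>x\<in>S. \<forall>y\<in>S. \<exists>g\<in>G. g x = y)"

definition perm_nontrivial :: "'a set \<Rightarrow> ('a \<Rightarrow> 'a) set \<Rightarrow> bool" where
  "perm_nontrivial S G \<longleftrightarrow> G \<noteq> {\<one>\<^bsub>BijGroup S\<^esub>}"

text \<open>Abstract simplicity (valid also for infinite groups; the library's simple_group
  uses order = card of the carrier, which is 0 for infinite groups).\<close>

definition is_simple :: "('g, 'b) monoid_scheme \<Rightarrow> bool" where
  "is_simple G \<longleftrightarrow> group G \<and> carrier G \<noteq> {\<one>\<^bsub>G\<^esub>} \<and>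
     (\<forall>H. normal H G \<longrightarrow> H = carrier G \<or> H = {\<one>\<^bsub>G\<^esub>})"

definition is_cycle :: "('v \<Rightarrow> 'v \<Rightarrow> bool) \<Rightarrow> 'v list \<Rightarrow> bool" where
  "is_cycle E vs \<longleftrightarrow> 3 \<le> length vs \<and> distinct vs \<and>
     (\<forall>i. Suc i < length vs \<longrightarrow> E (vs ! i) (vs ! Suc i)) \<and> E (last vs) (hd vs)"

definition is_tree :: "('v \<Rightarrow> 'v \<Rightarrow> bool) \<Rightarrow> bool" where
  "is_tree E \<longleftrightarrow> (\<forall>u v. E u v \<longrightarrow> E v u) \<and> (\<forall>v. \<not> E v v) \<and>
     (\<forall>u v. E\<^sup>*\<^sup>* u v) \<and> (\<forall>vs. \<not> is_cycle E vs)"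

definition biregular_tree ::
  "'a set \<Rightarrow> 'a set \<Rightarrow> ('v \<Rightarrow> 'v \<Rightarrow> bool) \<Rightarrow> 'v set \<Rightarrow> 'v set \<Rightarrow> bool" where
  "biregular_tree Xs Ys E VX VY \<longleftrightarrow> is_tree E \<and>
     VX \<inter> VY = {} \<and> VX \<union> VY = UNIV \<and>
     (\<forall>u v. E u v \<longrightarrow> (u \<in> VX \<longleftrightarrow> v \<in> VY)) \<and>
     (\<forall>v\<in>VX. eqpoll {w. E v w} Xs) \<and> (\<forall>v\<in>VY. eqpoll {w. E v w} Ys)"

text \<open>Arcs are pairs (u,w) with E u w; A(v) = arcs with origin v, identified with
  the neighbours of v.\<close>

definition legal_colouring ::
  "'a set \<Rightarrow> 'a set \<Rightarrow> ('v \<Rightarrow> 'v \<Rightarrow> bool) \<Rightarrow> 'v set \<Rightarrow> 'v set \<Rightarrow> ('v \<times> 'v \<Rightarrow> 'a) \<Rightarrow> bool" where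
  "legal_colouring Xs Ys E VX VY c \<longleftrightarrow>
     (\<forall>v\<in>VX. bij_betw (\<lambda>w. c (v, w)) {w. E v w} Xs) \<and>
     (\<forall>v\<in>VY. bij_betw (\<lambda>w. c (v, w)) {w. E v w} Ys) \<and>
     (\<forall>u w v. E u v \<longrightarrow> E w v \<longrightarrow> c (u, v) = c (w, v))"

definition tree_aut :: "('v \<Rightarrow> 'v \<Rightarrow> bool) \<Rightarrow> ('v \<Rightarrow> 'v) set" where
  "tree_aut E = {g. bij g \<and> (\<forall>u v. E u v \<longleftrightarrow> E (g u) (g v))}"

text \<open>Local action of g at v: the permutation c|A(gv) o g|A(v) o (c|A(v))^-1 of the
  colour set S (S = Xs for v in VX, S = Ys for v in VY), as an extensional map on S.\<close>

definition local_action ::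
  "'a set \<Rightarrow> ('v \<Rightarrow> 'v \<Rightarrow> bool) \<Rightarrow> ('v \<times> 'v \<Rightarrow> 'a) \<Rightarrow> ('v \<Rightarrow> 'v) \<Rightarrow> 'v \<Rightarrow> ('a \<Rightarrow> 'a)" where
  "local_action S E c g v =
     restrict (\<lambda>x. c (g v, g (THE w. E v w \<and> c (v, w) = x))) S"

definition U_c ::
  "'a set \<Rightarrow> 'a set \<Rightarrow> ('v \<Rightarrow> 'v \<Rightarrow> bool) \<Rightarrow> 'v set \<Rightarrow> 'v set \<Rightarrow> ('v \<times> 'v \<Rightarrow> 'a) \<Rightarrow>
   ('a \<Rightarrow> 'a) set \<Rightarrow> ('a \<Rightarrow> 'a) set \<Rightarrow> ('v \<Rightarrow> 'v) set" where
  "U_c Xs Ys E VX VY c M N =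
     {g \<in> tree_aut E. g ` VX = VX \<and>
        (\<forall>v\<in>VX. local_action Xs E c g v \<in> M) \<and>
        (\<forall>v\<in>VY. local_action Ys E c g v \<in> N)}"

definition box_product ::
  "'a set \<Rightarrow> 'a set \<Rightarrow> ('v \<Rightarrow> 'v \<Rightarrow> bool) \<Rightarrow> 'v set \<Rightarrow> 'v set \<Rightarrow> ('v \<times> 'v \<Rightarrow> 'a) \<Rightarrow>
   ('a \<Rightarrow> 'a) set \<Rightarrow> ('a \<Rightarrow> 'a) set \<Rightarrow> ('v \<Rightarrow> 'v) monoid" where
  "box_product Xs Ys E VX VY c M N =
     (BijGroup VY) \<lparr>carrier := (\<lambda>g. restrict g VY) ` U_c Xs Ys E VX VY c M N\<rparr>"

end

theory Submission
  imports Defs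
begin

text \<open>Since a legal colouring is constant on the arcs into a vertex, it is the same as a colouring of
  the vertices, and the orbits of \<open>U(M,N)\<close> on vertices and edges are governed by the orbits of \<open>M\<close> and
  \<open>N\<close> on colours: the quotient graph is complete bipartite on the two orbit sets.

  If neither group is transitive, this quotient contains a 4-cycle. A cocycle that does not vanish on
  it lifts to an integer height on the tree, and the elements preserving the height form a normal
  subgroup, which is proper and contains all vertex stabilisers.

  If one of the groups is transitive, every half-tree can be moved into every other one. A nontrivial
  normal subgroup \<open>H\<close> therefore contains some \<open>k\<close> for which the iterated images of a half-tree \<open>B\<close> are
  disjoint, and an element \<open>g\<close> supported on \<open>B\<close> is the commutator of \<open>k\<close> with the infinite product of
  the conjugates of \<open>g\<close> by the powers of \<open>k\<close>. So \<open>H\<close> contains all elements supported on half-trees,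
  hence all edge stabilisers, hence all vertex stabilisers because \<open>M\<close> and \<open>N\<close> are generated by point
  stabilisers. Being also transitive on one class of vertices, \<open>H\<close> is everything.\<close>

section \<open>Half-trees\<close>

text \<open>Loop erasure: when the new first vertex already lies on the path, everything before that
  occurrence is dropped. The last conclusion keeps the path inside the set reachable from
  \<open>x\<close>, so that in a tree a path inside a branch misses the base of the branch.\<close>

lemma rtranclp_distinct_path:
  assumes "R\<^sup>*\<^sup>* x y"
  obtains vs where "vs \<noteq> []" "hd vs = x" "last vs = y" "distinct vs" "successively R vs"
    "\<forall>z\<in>set vs. R\<^sup>*\<^sup>* x z"
proof -
  have "\<exists>vs. vs \<noteq> [] \<and> hd vs = x \<and> last vs = y \<and> distinct vs \<and> successively R vs \<and>
    (\<forall>z\<in>set vs. R\<^sup>*\<^sup>* x z)"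
    using assms
  proof (induction rule: converse_rtranclp_induct)
    case base
    show ?case by (intro exI[of _ "[y]"]) auto
  next
    case (step x w)
    then obtain vs where vs: "vs \<noteq> []" "hd vs = w" "last vs = y" "distinct vs" "successively R vs"
      "\<forall>z\<in>set vs. R\<^sup>*\<^sup>* w z"
      by blast
    show ?case
    proof (cases "x \<in> set vs")
      case True
      then obtain ys zs where eq: "vs = ys @ x # zs"
        by (meson split_list)
      have "\<forall>z\<in>set vs. R\<^sup>*\<^sup>* x z"
        using vs(6) step.hyps(1) by (meson converse_rtranclp_into_rtranclp)
      with vs eq show ?thesis
        by (intro exI[of _ "x # zs"]) (auto simp: successively_append_iff)
    next
      case False
      with vs step.hyps(1) show ?thesis
        by (intro exI[of _ "x # vs"])
          (auto simp: successively_Cons intro: converse_rtranclp_into_rtranclp)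
    qed
  qed
  with that show thesis by blast
qed

locale tree =
  fixes E :: "'v \<Rightarrow> 'v \<Rightarrow> bool"
  assumes is_tree: "is_tree E"
begin

lemma sym: "E u v \<Longrightarrow> E v u"
  and irrefl: "\<not> E v v"
  and connected: "E\<^sup>*\<^sup>* u v"
  and acyclic: "\<not> is_cycle E vs"
  using is_tree unfolding is_tree_def by blast+

lemma adj_neq: "E u v \<Longrightarrow> u \<noteq> v"
  using irrefl by blast

definition avoid :: "'v \<Rightarrow> 'v \<Rightarrow> 'v \<Rightarrow> bool" where
  "avoid a u v \<longleftrightarrow> E u v \<and> u \<noteq> a \<and> v \<noteq> a"

text \<open>For an edge \<open>(a, b)\<close> this is the half-tree beyond \<open>b\<close>: the
  component of \<open>b\<close> once \<open>a\<close> is deleted. Encoding it by reachability avoids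
  distances and geodesics; that it is the complement of \<open>half b a\<close> is shown
  below.\<close>

definition half :: "'v \<Rightarrow> 'v \<Rightarrow> 'v set" where
  "half a b = {x. (avoid a)\<^sup>*\<^sup>* b x}"

lemma half_root: "b \<in> half a b"
  by (simp add: half_def)

lemma half_step: "x \<in> half a b \<Longrightarrow> E x y \<Longrightarrow> x \<noteq> a \<Longrightarrow> y \<noteq> a \<Longrightarrow> y \<in> half a b"
  unfolding half_def by (auto intro: rtranclp.rtrancl_into_rtrancl simp: avoid_def)

lemma half_induct [consumes 1, case_names root step]:
  assumes "x \<in> half a b" "Q b"
    "\<And>x y. x \<in> half a b \<Longrightarrow> Q x \<Longrightarrow> E x y \<Longrightarrow> x \<noteq> a \<Longrightarrow> y \<noteq> a \<Longrightarrow> Q y"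
  shows "Q x"
proof -
  have "(avoid a)\<^sup>*\<^sup>* b x"
    using assms(1) by (simp add: half_def)
  then show ?thesis
  proof (induction rule: rtranclp_induct)
    case base
    show ?case by (fact assms(2))
  next
    case (step y z)
    then show ?case
      using assms(3)[of y z] by (auto simp: avoid_def half_def)
  qed
qed

lemma half_not_base: "E a b \<Longrightarrow> a \<notin> half a b"
proof
  assume "E a b" "a \<in> half a b"
  have "x \<noteq> a" if "x \<in> half a b" for x
    using that by (induction rule: half_induct) (use \<open>E a b\<close> adj_neq in auto)
  with \<open>a \<in> half a b\<close> show False by blast
qed

lemma half_closed: "E a b \<Longrightarrow> x \<in> half a b \<Longrightarrow> E x y \<Longrightarrow> y \<noteq> a \<Longrightarrow> y \<in> half a b"
  using half_step half_not_base by metis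

lemma half_sym: "x \<in> half a b \<Longrightarrow> b \<in> half a x"
proof (induction rule: half_induct)
  case root
  show ?case by (rule half_root)
next
  case (step x y)
  have "b' \<in> half a y" if "b' \<in> half a x" for b'
    using that
  proof (induction rule: half_induct)
    case root
    show ?case using step.hyps half_root half_step sym by metis
  next
    case (step u w)
    show ?case using step half_step by metis
  qed
  with step show ?case by blast
qed

lemma half_trans: "x \<in> half a b \<Longrightarrow> y \<in> half a x \<Longrightarrow> y \<in> half a b"
  unfolding half_def by auto

text \<open>Acyclicity enters here: a simple path from \<open>b\<close> to \<open>b'\<close> that
  misses \<open>a\<close> would be closed up by \<open>a\<close> to a cycle.\<close>

lemma branch_unique:
  assumes "E a b" "E a b'" "b' \<in> half a b"
  shows "b' = b"
proof (rule ccontr)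
  assume "b' \<noteq> b"
  obtain vs where vs: "vs \<noteq> []" "hd vs = b" "last vs = b'" "distinct vs"
    "successively (avoid a) vs" "\<forall>z\<in>set vs. (avoid a)\<^sup>*\<^sup>* b z"
    using rtranclp_distinct_path[of "avoid a" b b'] assms(3) unfolding half_def by blast
  have "a \<notin> set vs"
    using vs(6) half_not_base[OF assms(1)] by (auto simp: half_def)
  obtain v ws where "vs = v # ws" "ws \<noteq> []"
    using vs(1-3) \<open>b' \<noteq> b\<close> by (metis last.simps list.collapse)
  then have "3 \<le> length (a # vs)"
    by (cases ws) auto
  moreover have "successively E vs"
    by (rule successively_mono[OF vs(5)]) (auto simp: avoid_def)
  then have "successively E (a # vs)"
    using vs(1,2) assms(1) by (auto simp: successively_Cons)
  then have "\<forall>i. Suc i < length (a # vs) \<longrightarrow> E ((a # vs) ! i) ((a # vs) ! Suc i)"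
    unfolding successively_conv_nth by blast
  moreover have "E (last (a # vs)) (hd (a # vs))"
    using vs(1,3) assms(2) sym by simp
  ultimately have "is_cycle E (a # vs)"
    using vs(4) \<open>a \<notin> set vs\<close> unfolding is_cycle_def by simp
  with acyclic show False by blast
qed

lemma branches_disjoint:
  assumes "E a b" "E a b'" "b \<noteq> b'"
  shows "half a b \<inter> half a b' = {}"
  using assms branch_unique half_sym half_trans by blast

lemma half_Un_opposite:
  assumes "E a b"
  shows "half a b \<union> half b a = UNIV"
proof -
  have "x \<in> half a b \<union> half b a" for x
    using connected[of b x]
  proof (induction rule: rtranclp_induct)
    case base
    show ?case by (simp add: half_root)
  next
    case (step x y)
    then show ?case
      using half_closed[OF assms] half_closed[OF sym[OF assms]] half_root by blast
  qed
  then show ?thesis by blast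
qed

text \<open>A walk from \<open>a\<close> avoiding \<open>b\<close> can be cut at its last visit to \<open>a\<close>.\<close>
lemma half_opposite_branch:
  assumes "E a b" "x \<in> half b a" "x \<noteq> a"
  obtains a1 where "E a a1" "a1 \<noteq> b" "x \<in> half a a1"
proof -
  have "x = a \<or> (\<exists>a1. E a a1 \<and> a1 \<noteq> b \<and> x \<in> half a a1)"
    using assms(2)
  proof (induction rule: half_induct)
    case (step x y)
    then show ?case
      using half_step half_root by metis
  qed simp
  with assms(3) that show thesis by blast
qed

lemma half_Int_opposite:
  assumes "E a b"
  shows "half a b \<inter> half b a = {}"
proof -
  have False if x: "x \<in> half a b" "x \<in> half b a" for x
  proof -
    have "x \<noteq> a"
      using x(1) half_not_base[OF assms] by blast
    then obtain a1 where "E a a1" "a1 \<noteq> b" "x \<in> half a a1"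
      using half_opposite_branch[OF assms x(2)] by blast
    then show False
      using branches_disjoint[OF assms] x(1) by blast
  qed
  then show ?thesis by blast
qed

lemma half_opposite: "E a b \<Longrightarrow> half b a = - half a b"
  using half_Un_opposite half_Int_opposite by blast

lemma branch_exists:
  assumes "x \<noteq> a"
  obtains b where "E a b" "x \<in> half a b"
proof -
  have "x = a \<or> (\<exists>b. E a b \<and> x \<in> half a b)"
    using connected[of a x]
  proof (induction rule: rtranclp_induct)
    case (step x y)
    then show ?case
      using half_closed half_root by metis
  qed simp
  with assms that show thesis by blast
qed

text \<open>A walk inside \<open>half a b\<close> never meets \<open>c\<close>; having started next
  to \<open>a\<close>, it stays in the component \<open>half c q\<close>.\<close>

lemma half_subset:
  assumes "E a b" "E c q" "a \<in> half c q" "c \<notin> half a b"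
  shows "half a b \<subseteq> half c q"
proof
  fix x assume "x \<in> half a b"
  then show "x \<in> half c q"
  proof (induction rule: half_induct)
    case root
    show ?case
      using assms half_closed half_root by metis
  next
    case (step x y)
    then have "y \<in> half a b"
      using half_step by blast
    then show ?case
      using step assms half_closed by metis
  qed
qed

lemma half_next: "E a b \<Longrightarrow> E b w \<Longrightarrow> w \<noteq> a \<Longrightarrow> half b w \<subseteq> half a b"
  using half_subset[of b w a b] half_root branch_unique[of b w a] sym by blast

text \<open>Leaving a half-tree means stepping onto \<open>a\<close>, and \<open>b\<close> is the
  only neighbour of \<open>a\<close> inside it. The gluing arguments below rest on this single
  exit.\<close>

lemma half_crossing:
  assumes "E a b" "E x y" "x \<in> half a b" "y \<notin> half a b"
  shows "x = b \<and> y = a"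
proof -
  have "y = a"
    using assms half_closed by blast
  moreover have "x = b"
    using branch_unique[of a b x] assms sym \<open>y = a\<close> by blast
  ultimately show ?thesis by blast
qed

text \<open>An edge \<open>(x, y)\<close> points away from the root \<open>r\<close> iff \<open>r \<in> half y x\<close>.\<close>

lemma outward_cases:
  assumes "E x y"
  shows "r \<in> half y x \<longleftrightarrow> r \<notin> half x y"
  using half_opposite[OF assms] by blast

lemma outward_unique:
  assumes "E x y" "E x' y" "r \<in> half y x" "r \<in> half y x'"
  shows "x = x'"
  using assms branches_disjoint[of y x x'] sym by blast

lemma not_outward_root: "E x r \<Longrightarrow> r \<notin> half r x"
  using half_not_base sym by blast

section \<open>Recursion and induction outward from a root\<close>

text \<open>A vertex other than \<open>r\<close> has exactly one outward predecessor, so data can be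
  propagated from the root. The recursion is realised by reachability among pairs of a vertex and a
  state; \<open>unique\<close> and \<open>total\<close> make this relation the graph of a
  function.\<close>

lemma tree_rec:
  fixes s0 :: 's and F :: "'v \<Rightarrow> 'v \<Rightarrow> 's \<Rightarrow> 's"
  obtains s where "s r = s0" "\<And>x y. E x y \<Longrightarrow> r \<in> half y x \<Longrightarrow> s y = F x y (s x)"
proof -
  define Q where "Q = (\<lambda>q q' :: 'v \<times> 's. E (fst q) (fst q') \<and> r \<in> half (fst q') (fst q) \<and>
    snd q' = F (fst q) (fst q') (snd q))"
  have unique: "a = snd q" if "Q\<^sup>*\<^sup>* (r, s0) (y, a)" "Q\<^sup>*\<^sup>* (r, s0) q" "fst q = y" for y a q
    using that(2,1,3)
  proof (induction arbitrary: y a rule: rtranclp_induct)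
    case base
    from base show ?case
    proof (cases rule: rtranclp.cases)
      case rtrancl_refl
      then show ?thesis by simp
    next
      case (rtrancl_into_rtrancl q)
      then have "E (fst q) r" "r \<in> half r (fst q)"
        using base by (auto simp: Q_def)
      then show ?thesis
        using not_outward_root by blast
    qed
  next
    case (step q q')
    from step.prems(1) show ?case
    proof (cases rule: rtranclp.cases)
      case rtrancl_refl
      then have "E (fst q) r" "r \<in> half r (fst q)"
        using step by (auto simp: Q_def)
      then show ?thesis
        using not_outward_root by blast
    next
      case (rtrancl_into_rtrancl p)
      then have "fst p = fst q"
        using step outward_unique[of "fst p" y "fst q" r] by (auto simp: Q_def)
      moreover have "snd p = snd q"
        by (rule step.IH[of "fst q"])
          (use rtrancl_into_rtrancl(1) \<open>fst p = fst q\<close>[symmetric] in simp_all)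
      ultimately show ?thesis
        using rtrancl_into_rtrancl(2) step by (auto simp: Q_def)
    qed
  qed
  have total: "\<exists>a. Q\<^sup>*\<^sup>* (r, s0) (y, a)" for y
    using connected[of r y]
  proof (induction rule: rtranclp_induct)
    case base
    show ?case by blast
  next
    case (step y z)
    then obtain a where a: "Q\<^sup>*\<^sup>* (r, s0) (y, a)"
      by blast
    show ?case
    proof (cases "r \<in> half z y")
      case True
      then have "Q (y, a) (z, F y z a)"
        using step by (simp add: Q_def)
      with a show ?thesis
        by (meson rtranclp.rtrancl_into_rtrancl)
    next
      case False
      then have out: "r \<in> half y z"
        using outward_cases[OF step.hyps(2)] by blast
      from a show ?thesis
      proof (cases rule: rtranclp.cases)
        case rtrancl_refl
        then show ?thesis
          using out not_outward_root[of z r] step.hyps(2) sym by blast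
      next
        case (rtrancl_into_rtrancl p)
        then have "fst p = z"
          using outward_unique[of "fst p" y z r] out step.hyps(2) sym by (auto simp: Q_def)
        then show ?thesis
          using rtrancl_into_rtrancl(1) by (metis prod.collapse)
      qed
    qed
  qed
  define s where "s y = (SOME a. Q\<^sup>*\<^sup>* (r, s0) (y, a))" for y
  have s: "Q\<^sup>*\<^sup>* (r, s0) (y, s y)" for y
    unfolding s_def using total by (rule someI_ex)
  show thesis
  proof
    show "s r = s0"
      using unique[OF s, of "(r, s0)"] by simp
    show "s y = F x y (s x)" if "E x y" "r \<in> half y x" for x y
    proof -
      have "Q (x, s x) (y, F x y (s x))"
        using that by (simp add: Q_def)
      then have "Q\<^sup>*\<^sup>* (r, s0) (y, F x y (s x))"
        using s by (meson rtranclp.rtrancl_into_rtrancl)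
      with unique[OF s this] show ?thesis by simp
    qed
  qed
qed

text \<open>Induction on the depth, which is itself obtained by outward recursion with
  \<open>Suc\<close>.\<close>

lemma outward_induct [case_names root step]:
  assumes "Q r"
    "\<And>x y. E x y \<Longrightarrow> r \<in> half y x \<Longrightarrow> Q x \<Longrightarrow> Q y"
  shows "Q y"
proof -
  obtain d :: "'v \<Rightarrow> nat" where d: "d r = 0" "\<And>x y. E x y \<Longrightarrow> r \<in> half y x \<Longrightarrow> d y = Suc (d x)"
    using tree_rec[of r 0 "\<lambda>_ _. Suc"] by blast
  show ?thesis
  proof (induction "d y" arbitrary: y rule: less_induct)
    case less
    show ?case
    proof (cases "y = r")
      case False
      then obtain x where "E y x" "r \<in> half y x"
        using branch_exists by metis
      then show ?thesis
        using d(2)[of x y] less[of x] assms(2)[of x y] sym by auto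
    qed (use assms in simp)
  qed
qed

text \<open>Local injectivity makes outward edges map to outward edges, so distinct vertices stay
  separated.\<close>
lemma locally_inj_imp_inj:
  assumes "\<And>x y. E x y \<Longrightarrow> E (g x) (g y)"
    and "\<And>x y z. E x y \<Longrightarrow> E x z \<Longrightarrow> y \<noteq> z \<Longrightarrow> g y \<noteq> g z"
  shows "inj g"
proof (rule injI, rule ccontr)
  fix r y assume eq: "g r = g y" and "r \<noteq> y"
  have "\<forall>x. E x y \<longrightarrow> r \<in> half y x \<longrightarrow> g r \<in> half (g y) (g x)" for y
  proof (induction y rule: outward_induct[where r = r])
    case root
    show ?case using not_outward_root by blast
  next
    case (step x y)
    have "g r \<in> half (g y) (g x)"
    proof (cases "x = r")
      case True
      then show ?thesis by (simp add: half_root)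
    next
      case False
      then obtain p where p: "E x p" "r \<in> half x p"
        by (metis branch_exists)
      then have "g r \<in> half (g x) (g p)"
        using step.IH sym by blast
      moreover have "p \<noteq> y"
        using p(2) step.hyps outward_cases by blast
      ultimately have "g r \<notin> half (g x) (g y)"
        using branches_disjoint[of "g x" "g p" "g y"] assms p(1) step.hyps(1) by blast
      then show ?thesis
        using outward_cases[OF assms(1)[OF step.hyps(1)]] by blast
    qed
    then show ?case
      using step.hyps outward_unique by blast
  qed
  moreover obtain x where "E y x" "r \<in> half y x"
    using \<open>r \<noteq> y\<close> branch_exists by metis
  ultimately have "g y \<in> half (g y) (g x)" "E (g y) (g x)"
    using eq assms(1) sym by auto
  then show False
    using half_not_base by blast
qed

text \<open>The range is nonempty and closed under adjacency, so connectedness applies. Here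
  \<open>undefined\<close> is an arbitrary starting vertex.\<close>

lemma locally_surj_imp_surj:
  assumes "\<And>x z. E (g x) z \<Longrightarrow> \<exists>y. g y = z"
  shows "surj g"
proof -
  have "z \<in> range g" for z
    using connected[of "g undefined" z]
    by (induction rule: rtranclp_induct) (use assms in blast)+
  then show ?thesis by blast
qed

lemma tree_aut_half:
  assumes "g \<in> tree_aut E"
  shows "g ` half a b = half (g a) (g b)"
proof -
  have g: "bij g" "\<And>u v. E (g u) (g v) \<longleftrightarrow> E u v"
    using assms by (auto simp: tree_aut_def)
  then have eq: "g u = g v \<longleftrightarrow> u = v" for u v
    by (meson bij_is_inj injD)
  show ?thesis
  proof
    show "g ` half a b \<subseteq> half (g a) (g b)"
    proof
      fix y assume "y \<in> g ` half a b"
      then obtain x where "y = g x" "x \<in> half a b" by blast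
      have "g x \<in> half (g a) (g b)"
        using \<open>x \<in> half a b\<close>
      proof (induction rule: half_induct)
        case (step x y)
        then show ?case
          using half_step[of "g x" "g a" "g b" "g y"] g(2) eq by blast
      qed (rule half_root)
      then show "y \<in> half (g a) (g b)" using \<open>y = g x\<close> by simp
    qed
    show "half (g a) (g b) \<subseteq> g ` half a b"
    proof
      fix y assume "y \<in> half (g a) (g b)"
      then show "y \<in> g ` half a b"
      proof (induction rule: half_induct)
        case (step x y)
        obtain z where "y = g z" using g(1) by (metis bij_pointE)
        with step show ?case
          using half_step[of _ a b z] g(2) eq by blast
      qed (use half_root in blast)
    qed
  qed
qed

end

section \<open>The universal group of a coloured tree\<close>

abbreviation inv_perm :: "('v \<Rightarrow> 'v) \<Rightarrow> 'v \<Rightarrow> 'v" where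
  "inv_perm \<equiv> inv_into UNIV"

text \<open>\<open>side\<close> is membership in \<open>VX\<close>, \<open>t v\<close> is the common colour of the arcs into \<open>v\<close>, and
  \<open>C i\<close>, \<open>P i\<close> are the colour set and the permutation group used at the vertices of side \<open>i\<close>.\<close>
locale coloured_tree = tree E
  for E :: "'v \<Rightarrow> 'v \<Rightarrow> bool" +
  fixes side :: "'v \<Rightarrow> bool" and t :: "'v \<Rightarrow> 'a"
    and C :: "bool \<Rightarrow> 'a set" and P :: "bool \<Rightarrow> ('a \<Rightarrow> 'a) set"
  assumes side_adj: "E u v \<Longrightarrow> side v \<longleftrightarrow> \<not> side u"
    and bij_colours: "bij_betw t {w. E v w} (C (side v))"
    and two_colours: "\<exists>a b. a \<in> C i \<and> b \<in> C i \<and> a \<noteq> b"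
    and perm: "subgroup (P i) (BijGroup (C i))"
begin

lemma P_bij: "\<sigma> \<in> P i \<Longrightarrow> bij_betw \<sigma> (C i) (C i)"
  and P_ext: "\<sigma> \<in> P i \<Longrightarrow> \<sigma> \<in> extensional (C i)"
  using subgroup.subset[OF perm[of i]] by (auto simp: BijGroup_def Bij_def)

lemma P_one: "(\<lambda>x\<in>C i. x) \<in> P i"
  using subgroup.one_closed[OF perm[of i]] by (simp add: BijGroup_def)

lemma P_compose: "\<sigma> \<in> P i \<Longrightarrow> \<tau> \<in> P i \<Longrightarrow> compose (C i) \<sigma> \<tau> \<in> P i"
  using subgroup.m_closed[OF perm[of i], of \<sigma> \<tau>] P_bij P_ext by (simp add: BijGroup_def Bij_def)

lemma P_inv: "\<sigma> \<in> P i \<Longrightarrow> (\<lambda>x\<in>C i. inv_into (C i) \<sigma> x) \<in> P i"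
  using subgroup.m_inv_closed[OF perm[of i], of \<sigma>] P_bij P_ext
  by (simp add: inv_BijGroup Bij_def)

lemma P_closed: "\<sigma> \<in> P i \<Longrightarrow> x \<in> C i \<Longrightarrow> \<sigma> x \<in> C i"
  using P_bij bij_betwE by blast

lemma colour_in: "E v w \<Longrightarrow> t w \<in> C (side v)"
  using bij_colours[of v] by (auto dest: bij_betwE)

lemma colour_inj: "E v w \<Longrightarrow> E v w' \<Longrightarrow> t w = t w' \<Longrightarrow> w = w'"
  using bij_colours[of v] by (auto simp: bij_betw_def dest: inj_onD)

lemma neighbour_of_colour:
  assumes "a \<in> C (side v)"
  obtains w where "E v w" "t w = a"
proof -
  have "a \<in> t ` {w. E v w}"
    using bij_colours[of v] assms by (simp add: bij_betw_def)
  with that show thesis by auto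
qed

lemma another_neighbour:
  obtains w where "E v w" "w \<noteq> u"
proof -
  obtain a b where "a \<in> C (side v)" "b \<in> C (side v)" "a \<noteq> b"
    using two_colours by blast
  then show thesis
    using neighbour_of_colour that by metis
qed

lemma colour_in': "t v \<in> C (\<not> side v)"
proof -
  obtain w where "E v w"
    using another_neighbour by blast
  then show ?thesis
    using colour_in[OF sym] side_adj by simp
qed

text \<open>This is \<open>U_c\<close>, with the local action described through a witness \<sigma>
  instead of an explicit formula and with sides preserved pointwise. The identification with
  \<open>U_c\<close> is made in the final theorem.\<close>

definition U :: "('v \<Rightarrow> 'v) set" where
  "U = {g \<in> tree_aut E. (\<forall>v. side (g v) = side v) \<and>
     (\<forall>v. \<exists>\<sigma>\<in>P (side v). \<forall>w. E v w \<longrightarrow> t (g w) = \<sigma> (t w))}"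

lemma U_tree_aut: "g \<in> U \<Longrightarrow> g \<in> tree_aut E"
  and U_side: "g \<in> U \<Longrightarrow> side (g v) = side v"
  and U_adj: "g \<in> U \<Longrightarrow> E (g x) (g y) \<longleftrightarrow> E x y"
  and U_bij: "g \<in> U \<Longrightarrow> bij g"
  by (auto simp: U_def tree_aut_def)

lemma U_eq_iff: "g \<in> U \<Longrightarrow> g x = g y \<longleftrightarrow> x = y"
  by (meson U_bij bij_is_inj injD)

lemma U_inv_apply [simp]: "g \<in> U \<Longrightarrow> inv_perm g (g x) = x" "g \<in> U \<Longrightarrow> g (inv_perm g x) = x"
  by (simp_all add: U_bij bij_is_inj bij_is_surj surj_f_inv_f)

lemma U_half: "g \<in> U \<Longrightarrow> g ` half a b = half (g a) (g b)"
  by (simp add: U_tree_aut tree_aut_half)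

lemma U_local_action:
  assumes "g \<in> U"
  obtains \<sigma> where "\<sigma> \<in> P (side v)" "\<And>w. E v w \<Longrightarrow> t (g w) = \<sigma> (t w)"
  using assms unfolding U_def by blast

text \<open>A permutation of colours at each vertex makes \<open>g\<close> a bijection from the
  neighbours of \<open>x\<close> to those of \<open>g x\<close>. On a tree local injectivity yields
  injectivity, and local surjectivity yields surjectivity, so \<open>g\<close> is an
  automorphism.\<close>

lemma U_I:
  assumes side: "\<And>x. side (g x) = side x"
    and loc: "\<And>x. \<exists>\<sigma>\<in>P (side x). \<forall>y. E x y \<longrightarrow> E (g x) (g y) \<and> t (g y) = \<sigma> (t y)"
  shows "g \<in> U"
proof -
  have adj: "E (g x) (g y)" if "E x y" for x y
    using loc that by blast
  have surj_loc: "\<exists>y. E x y \<and> g y = z" if "E (g x) z" for x z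
  proof -
    obtain \<sigma> where \<sigma>: "\<sigma> \<in> P (side x)" "\<And>y. E x y \<Longrightarrow> t (g y) = \<sigma> (t y)"
      using loc by blast
    have "t z \<in> \<sigma> ` C (side x)"
      using colour_in[OF that] side P_bij[OF \<sigma>(1)] by (simp add: bij_betw_def)
    then obtain y where y: "E x y" "\<sigma> (t y) = t z"
      using neighbour_of_colour by (metis imageE)
    then have "g y = z"
      using colour_inj[OF adj that] \<sigma>(2) by auto
    with y show ?thesis by blast
  qed
  have "inj g"
  proof (rule locally_inj_imp_inj[OF adj])
    fix x y z assume xyz: "E x y" "E x z" "y \<noteq> z"
    obtain \<sigma> where \<sigma>: "\<sigma> \<in> P (side x)" "\<And>y. E x y \<Longrightarrow> t (g y) = \<sigma> (t y)"
      using loc by blast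
    have "t y \<noteq> t z"
      using xyz colour_inj by blast
    then have "\<sigma> (t y) \<noteq> \<sigma> (t z)"
      using P_bij[OF \<sigma>(1)] xyz colour_in by (meson bij_betw_imp_inj_on inj_onD)
    then show "g y \<noteq> g z"
      using \<sigma>(2) xyz by metis
  qed
  moreover have "surj g"
    using surj_loc by (intro locally_surj_imp_surj) blast
  moreover have "E x y" if "E (g x) (g y)" for x y
    using surj_loc[OF that] \<open>inj g\<close> by (metis injD)
  ultimately have "bij g \<and> (\<forall>u v. E u v \<longleftrightarrow> E (g u) (g v))"
    using adj by (metis bijI)
  then have "g \<in> tree_aut E"
    by (simp add: tree_aut_def)
  then show ?thesis
    using side loc unfolding U_def by blast
qed

text \<open>Membership in \<open>U\<close> is a condition on balls of radius one. This allows
  elements to be glued from pieces, even from infinitely many.\<close>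

lemma U_locally:
  assumes "\<And>x. \<exists>g\<in>U. g x = k x \<and> (\<forall>y. E x y \<longrightarrow> g y = k y)"
  shows "k \<in> U"
proof (rule U_I)
  fix x
  obtain g where g: "g \<in> U" "g x = k x" "\<And>y. E x y \<Longrightarrow> g y = k y"
    using assms by blast
  show "side (k x) = side x"
    using g U_side by metis
  obtain \<sigma> where "\<sigma> \<in> P (side x)" "\<And>w. E x w \<Longrightarrow> t (g w) = \<sigma> (t w)"
    using U_local_action[OF g(1)] by blast
  then show "\<exists>\<sigma>\<in>P (side x). \<forall>y. E x y \<longrightarrow> E (k x) (k y) \<and> t (k y) = \<sigma> (t y)"
    using g U_adj by metis
qed

lemma U_id: "id \<in> U"
proof (rule U_I)
  fix x
  show "\<exists>\<sigma>\<in>P (side x). \<forall>y. E x y \<longrightarrow> E (id x) (id y) \<and> t (id y) = \<sigma> (t y)"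
    by (rule bexI[OF _ P_one]) (simp add: colour_in)
qed simp

lemma U_comp:
  assumes "g \<in> U" "h \<in> U"
  shows "g \<circ> h \<in> U"
proof (rule U_I)
  fix x
  show "side ((g \<circ> h) x) = side x"
    using assms by (simp add: U_side)
  obtain \<sigma> where \<sigma>: "\<sigma> \<in> P (side x)" "\<And>w. E x w \<Longrightarrow> t (h w) = \<sigma> (t w)"
    using U_local_action[OF assms(2)] by blast
  obtain \<tau> where \<tau>: "\<tau> \<in> P (side x)" "\<And>w. E (h x) w \<Longrightarrow> t (g w) = \<tau> (t w)"
    using U_local_action[OF assms(1), of "h x"] unfolding U_side[OF assms(2)] by blast
  show "\<exists>\<sigma>\<in>P (side x). \<forall>y. E x y \<longrightarrow> E ((g \<circ> h) x) ((g \<circ> h) y) \<and> t ((g \<circ> h) y) = \<sigma> (t y)"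
    by (rule bexI[OF _ P_compose[OF \<tau>(1) \<sigma>(1)]])
      (use \<sigma>(2) \<tau>(2) assms in \<open>auto simp: U_adj compose_eq colour_in\<close>)
qed

lemma U_inv:
  assumes "g \<in> U"
  shows "inv_perm g \<in> U"
proof (rule U_I)
  fix x
  show side: "side (inv_perm g x) = side x"
    using assms U_side[of g "inv_perm g x"] by simp
  obtain \<sigma> where \<sigma>: "\<sigma> \<in> P (side x)" "\<And>w. E (inv_perm g x) w \<Longrightarrow> t (g w) = \<sigma> (t w)"
    using U_local_action[OF assms, of "inv_perm g x"] unfolding side by blast
  have "E (inv_perm g x) (inv_perm g y) \<and> t (inv_perm g y) = (\<lambda>a\<in>C (side x). inv_into (C (side x)) \<sigma> a) (t y)"
    if "E x y" for y
  proof -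
    have adj: "E (inv_perm g x) (inv_perm g y)"
      using that assms U_adj[of g "inv_perm g x" "inv_perm g y"] by simp
    then have "t y = \<sigma> (t (inv_perm g y))" "t (inv_perm g y) \<in> C (side x)"
      using \<sigma>(2) assms colour_in side by fastforce+
    then have "inv_into (C (side x)) \<sigma> (t y) = t (inv_perm g y)"
      using P_bij[OF \<sigma>(1)] by (simp add: bij_betw_def inv_into_f_f)
    then show ?thesis
      using adj that colour_in by simp
  qed
  then show "\<exists>\<sigma>\<in>P (side x). \<forall>y. E x y \<longrightarrow> E (inv_perm g x) (inv_perm g y) \<and> t (inv_perm g y) = \<sigma> (t y)"
    using P_inv[OF \<sigma>(1)] by blast
qed

section \<open>Elements with prescribed local behaviour\<close>

text \<open>The element is built outward from \<open>r\<close>, with a local permutation chosen at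
  each vertex. At a new vertex \<open>y\<close> it has to carry the colour of the predecessor
  \<open>x\<close> to the colour of its image, which is possible because the two colours lie in one
  orbit; the permutation at \<open>x\<close> in turn shows the same for \<open>y\<close>.\<close>

lemma U_extend:
  assumes side: "side r' = side r"
    and "\<tau> \<in> P (\<not> side r)" "\<tau> (t r) = t r'"
    and "\<sigma> \<in> P (side r)"
  obtains u where "u \<in> U" "u r = r'" "\<And>y. E r y \<Longrightarrow> t (u y) = \<sigma> (t y)"
proof -
  \<comment> \<open>A state is the image of a vertex together with the local permutation there. The
    last condition makes the choice at \<open>y\<close> agree with the edge back to
    \<open>x\<close>.\<close>
  define F where "F x y q =
    (SOME q'. E (fst q) (fst q') \<and> t (fst q') = snd q (t y) \<and>
              snd q' \<in> P (side y) \<and> snd q' (t x) = t (fst q))"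
    for x y and q :: "'v \<times> ('a \<Rightarrow> 'a)"
  obtain s where s: "s r = (r', \<sigma>)" "\<And>x y. E x y \<Longrightarrow> r \<in> half y x \<Longrightarrow> s y = F x y (s x)"
    using tree_rec[of r "(r', \<sigma>)" F] by blast
  define g where "g = fst \<circ> s"
  define loc where "loc = snd \<circ> s"
  have outward: "E (g x) (g y) \<and> t (g y) = loc x (t y) \<and> loc y \<in> P (side y) \<and> loc y (t x) = t (g x)"
    if xy: "E x y" "r \<in> half y x" and x: "side (g x) = side x" "loc x \<in> P (side x)"
      and orbit: "\<exists>\<rho>\<in>P (\<not> side x). \<rho> (t x) = t (g x)" for x y
  proof -
    have "loc x (t y) \<in> C (side (g x))"
      using xy x P_closed colour_in by simp
    then obtain y' where "E (g x) y'" "t y' = loc x (t y)"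
      using neighbour_of_colour by blast
    moreover obtain \<rho> where "\<rho> \<in> P (side y)" "\<rho> (t x) = t (g x)"
      using orbit side_adj[OF xy(1)] by auto
    ultimately have "\<exists>q'. E (fst (s x)) (fst q') \<and> t (fst q') = snd (s x) (t y) \<and>
              snd q' \<in> P (side y) \<and> snd q' (t x) = t (fst (s x))"
      by (intro exI[of _ "(y', \<rho>)"]) (simp add: g_def loc_def)
    from someI_ex[OF this] show ?thesis
      using s(2)[OF xy] by (simp add: g_def loc_def F_def)
  qed
  have inv: "side (g x) = side x \<and> loc x \<in> P (side x) \<and> (\<exists>\<rho>\<in>P (\<not> side x). \<rho> (t x) = t (g x))" for x
  proof (induction x rule: outward_induct[where r = r])
    case root
    show ?case
      using s(1) assms by (auto simp: g_def loc_def)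
  next
    case (step x y)
    then have "E (g x) (g y)" "t (g y) = loc x (t y)" "loc y \<in> P (side y)"
      using outward by blast+
    moreover have "side (g y) = side y"
      using side_adj[OF \<open>E (g x) (g y)\<close>] side_adj[OF step.hyps(1)] step.IH by simp
    moreover have "loc x \<in> P (\<not> side y)"
      using step side_adj by simp
    ultimately show ?case by metis
  qed
  have adj: "E (g x) (g y) \<and> t (g y) = loc x (t y)" if "E x y" for x y
  proof (cases "r \<in> half y x")
    case True
    then show ?thesis
      using outward[OF that True] inv by blast
  next
    \<comment> \<open>An inward edge is the reverse of an outward one, and its equation is the
      condition imposed when the permutation at \<open>x\<close> was chosen.\<close>
    case False
    then have "r \<in> half x y"
      using outward_cases[OF that] by blast
    then show ?thesis
      using outward[OF sym[OF that]] inv[of y] sym[of "g y" "g x"] by simp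
  qed
  show thesis
  proof
    show "g \<in> U"
    proof (rule U_I)
      fix x
      show "side (g x) = side x"
        using inv by blast
      show "\<exists>\<sigma>\<in>P (side x). \<forall>y. E x y \<longrightarrow> E (g x) (g y) \<and> t (g y) = \<sigma> (t y)"
        using inv[of x] adj by blast
    qed
    show "g r = r'"
      by (simp add: g_def s(1))
    show "t (g y) = \<sigma> (t y)" if "E r y" for y
      using adj[OF that] s(1) by (simp add: loc_def)
  qed
qed

lemma U_extend_fixing:
  assumes "\<sigma> \<in> P (side r)"
  obtains u where "u \<in> U" "u r = r" "\<And>y. E r y \<Longrightarrow> t (u y) = \<sigma> (t y)"
proof (rule U_extend[OF refl P_one _ assms])
  show "(\<lambda>x\<in>C (\<not> side r). x) (t r) = t r"
    using colour_in' by simp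
qed (use that in blast)

text \<open>A nontrivial permutation of colours is realised around a fixed vertex \<open>v\<close>.
  In the intransitive case this fixed vertex puts \<open>u\<close> into the height-preserving
  subgroup.\<close>

lemma U_nontrivial:
  assumes "P i \<noteq> {\<lambda>x\<in>C i. x}"
  obtains u v where "u \<in> U" "u v = v" "u \<noteq> id"
proof -
  obtain \<sigma> where \<sigma>: "\<sigma> \<in> P i" "\<sigma> \<noteq> (\<lambda>x\<in>C i. x)"
    using assms P_one by blast
  then obtain a where a: "a \<in> C i" "\<sigma> a \<noteq> a"
    using P_ext[OF \<sigma>(1)] by (metis extensionalityI restrict_apply restrict_extensional)
  obtain v where v: "side v = i"
    using another_neighbour[of undefined] side_adj by (metis (full_types))
  then obtain u where u: "u \<in> U" "u v = v" "\<And>y. E v y \<Longrightarrow> t (u y) = \<sigma> (t y)"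
    using U_extend_fixing \<sigma>(1) by blast
  obtain y where "E v y" "t y = a"
    using neighbour_of_colour a v by blast
  with u(3) a have "u y \<noteq> y" by metis
  then have "u \<noteq> id" by auto
  with u that show thesis by blast
qed

lemma U_vertex_transport:
  assumes "side v' = side v" "t v' = t v"
  obtains g where "g \<in> U" "g v = v'"
proof (rule U_extend[OF assms(1) P_one _ P_one])
  show "(\<lambda>x\<in>C (\<not> side v). x) (t v) = t v'"
    using colour_in' assms(2) by simp
qed (use that in blast)

section \<open>An equivariant height in the intransitive case\<close>

text \<open>The height sums an antisymmetric edge weight that is invariant under \<open>U\<close>,
  so an element changes all heights by the same amount. The weight has nonzero sum around a 4-cycle
  of the quotient, and a lift of this cycle joins two vertices of one orbit at different
  heights.\<close>

lemma intransitive_height: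
  assumes "\<And>i. \<not> perm_transitive (C i) (P i)"
  obtains \<psi> :: "'v \<Rightarrow> int" where
    "\<And>g x y. g \<in> U \<Longrightarrow> \<psi> (g x) - \<psi> x = \<psi> (g y) - \<psi> y"
    "\<exists>g\<in>U. \<exists>x. \<psi> (g x) \<noteq> \<psi> x"
proof -
  have "\<exists>a b. a \<in> C i \<and> b \<in> C i \<and> (\<forall>\<sigma>\<in>P i. \<sigma> a \<noteq> b)" for i
    using assms[of i] unfolding perm_transitive_def by blast
  then obtain a b where ab: "\<And>i. a i \<in> C i" "\<And>i. b i \<in> C i" "\<And>i \<sigma>. \<sigma> \<in> P i \<Longrightarrow> \<sigma> (a i) \<noteq> b i"
    by metis
  define orb where "orb i = {\<sigma> (a i) | \<sigma>. \<sigma> \<in> P i}" for i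
  have a_orb: "a i \<in> orb i" for i
  proof -
    have "a i = (\<lambda>x\<in>C i. x) (a i)"
      using ab by simp
    then show ?thesis
      unfolding orb_def using P_one[of i] by blast
  qed
  have b_orb: "b i \<notin> orb i" for i
  proof
    assume "b i \<in> orb i"
    then obtain \<sigma> where "\<sigma> \<in> P i" "b i = \<sigma> (a i)"
      unfolding orb_def by blast
    then show False
      using ab(3)[of \<sigma> i] by simp
  qed
  have orb_imp: "\<sigma> x \<in> orb i" if \<sigma>: "\<sigma> \<in> P i" and x: "x \<in> orb i" for \<sigma> x i
  proof -
    obtain \<tau> where \<tau>: "\<tau> \<in> P i" "x = \<tau> (a i)"
      using x unfolding orb_def by blast
    then have "\<sigma> x = compose (C i) \<sigma> \<tau> (a i)"
      using ab by (simp add: compose_eq)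
    then show ?thesis
      unfolding orb_def using P_compose[OF \<sigma> \<tau>(1)] by blast
  qed
  have orb_iff: "\<sigma> x \<in> orb i \<longleftrightarrow> x \<in> orb i" if "\<sigma> \<in> P i" "x \<in> C i" for \<sigma> x i
  proof
    assume "\<sigma> x \<in> orb i"
    then have "(\<lambda>x\<in>C i. inv_into (C i) \<sigma> x) (\<sigma> x) \<in> orb i"
      using orb_imp P_inv that(1) by blast
    then show "x \<in> orb i"
      using that P_closed[OF that] P_bij[OF that(1)] by (simp add: bij_betw_def inv_into_f_f)
  qed (use that orb_imp in blast)
  \<comment> \<open>The colour of a vertex is read at its neighbours, hence the orbit belongs to the
    opposite side.\<close>
  define mark where "mark x \<longleftrightarrow> t x \<in> orb (\<not> side x)" for x
  have mark_U: "mark (g x) \<longleftrightarrow> mark x" if "g \<in> U" for g x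
  proof -
    obtain z where z: "E x z"
      using another_neighbour by blast
    obtain \<sigma> where \<sigma>: "\<sigma> \<in> P (side z)" "\<And>w. E z w \<Longrightarrow> t (g w) = \<sigma> (t w)"
      using U_local_action[OF \<open>g \<in> U\<close>] by blast
    show ?thesis
      using \<sigma>(2)[OF sym[OF z]] orb_iff[OF \<sigma>(1) colour_in[OF sym[OF z]]] U_side[OF that]
        side_adj[OF z] by (simp add: mark_def)
  qed
  \<comment> \<open>The sign depending on the side makes \<open>f\<close> antisymmetric on
    edges.\<close>
  define f :: "'v \<Rightarrow> 'v \<Rightarrow> int" where
    "f x y = (if mark x \<and> mark y then if side x then 1 else -1 else 0)" for x y
  obtain \<psi> where \<psi>: "\<And>x y. E x y \<Longrightarrow> undefined \<in> half y x \<Longrightarrow> \<psi> y = \<psi> x + f x y"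
    using tree_rec[of undefined 0 "\<lambda>x y n. n + f x y"] by blast
  have edge: "\<psi> y = \<psi> x + f x y" if "E x y" for x y
  proof (cases "undefined \<in> half y x")
    case False
    then have "\<psi> x = \<psi> y + f y x"
      using \<psi>[OF sym[OF that]] outward_cases[OF that] by blast
    moreover have "f y x = - f x y"
      using side_adj[OF that] by (simp add: f_def)
    ultimately show ?thesis by simp
  qed (use \<psi> that in blast)
  show thesis
  proof
    fix g x y assume "g \<in> U"
    show "\<psi> (g x) - \<psi> x = \<psi> (g y) - \<psi> y"
      using connected[of x y]
    proof (induction rule: rtranclp_induct)
      case (step y z)
      have "f (g y) (g z) = f y z"
        using \<open>g \<in> U\<close> by (simp add: f_def mark_U U_side)
      then show ?case
        using step edge[of y z] edge[of "g y" "g z"] U_adj[OF \<open>g \<in> U\<close>] by simp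
    qed simp
  next
    \<comment> \<open>A lift of the 4-cycle, with vertex colours \<open>a True\<close>,
      \<open>a False\<close>, \<open>b True\<close>, \<open>b False\<close> and again
      \<open>a True\<close>; \<open>w\<close> only supplies a vertex next to which \<open>v\<close>
      is found. Only the edge from \<open>v\<close> to \<open>u\<close> has two marked ends, so the
      height drops by 1, while \<open>v\<close> and \<open>v'\<close> share side and colour.\<close>
    obtain w where w: "side w"
      using another_neighbour[of undefined] side_adj by (metis (full_types))
    obtain v where v: "E w v" "t v = a True"
      using neighbour_of_colour[of "a True" w] ab w by auto
    have sv: "\<not> side v"
      using side_adj[OF v(1)] w by simp
    obtain u where u: "E v u" "t u = a False"
      using neighbour_of_colour[of "a False" v] ab sv by auto
    have su: "side u"
      using side_adj[OF u(1)] sv by simp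
    obtain v2 where v2: "E u v2" "t v2 = b True"
      using neighbour_of_colour[of "b True" u] ab su by auto
    have sv2: "\<not> side v2"
      using side_adj[OF v2(1)] su by simp
    obtain u2 where u2: "E v2 u2" "t u2 = b False"
      using neighbour_of_colour[of "b False" v2] ab sv2 by auto
    have su2: "side u2"
      using side_adj[OF u2(1)] sv2 by simp
    obtain v' where v': "E u2 v'" "t v' = a True"
      using neighbour_of_colour[of "a True" u2] ab su2 by auto
    have sv': "\<not> side v'"
      using side_adj[OF v'(1)] su2 by simp
    have "\<psi> v' = \<psi> v - 1"
      using edge[OF u(1)] edge[OF v2(1)] edge[OF u2(1)] edge[OF v'(1)] sv su sv2 su2 sv'
        u v v2 u2 v' a_orb b_orb by (simp add: f_def mark_def)
    moreover obtain g where "g \<in> U" "g v = v'"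
      using U_vertex_transport[of v' v] v v' sv sv' by auto
    ultimately show "\<exists>g\<in>U. \<exists>x. \<psi> (g x) \<noteq> \<psi> x"
      by (intro bexI[of _ g] exI[of _ v]) auto
  qed
qed

section \<open>Moving and displacing half-trees\<close>

text \<open>One step deeper corrects the side of the base vertex, two further steps its colour; each
  passes to a smaller half-tree.\<close>

lemma half_contains_colour:
  assumes "E a b" "x \<in> C (\<not> j)"
  obtains p q where "E p q" "side p = j" "t p = x" "half p q \<subseteq> half a b"
proof -
  obtain p q where pq: "E p q" "side p = j" "half p q \<subseteq> half a b"
  proof (cases "side a = j")
    case False
    obtain w where "E b w" "w \<noteq> a"
      using another_neighbour by blast
    then show thesis
      using that[of b w] half_next[OF assms(1)] side_adj[OF assms(1)] False by auto
  qed (use assms that in blast)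
  show thesis
  proof (cases "t p = x")
    case False
    have "x \<in> C (side q)"
      using assms(2) side_adj[OF pq(1)] pq(2) by simp
    then obtain p' where p': "E q p'" "t p' = x"
      using neighbour_of_colour by blast
    then have "p' \<noteq> p"
      using False by blast
    obtain q' where q': "E p' q'" "q' \<noteq> q"
      using another_neighbour by blast
    have "half p' q' \<subseteq> half a b"
      using half_next[OF pq(1) p'(1) \<open>p' \<noteq> p\<close>] half_next[OF p'(1) q'] pq(3) by blast
    moreover have "side p' = j"
      using side_adj[OF p'(1)] side_adj[OF pq(1)] pq(2) by simp
    ultimately show thesis
      using that p' q' by blast
  qed (use pq that in blast)
qed

text \<open>The orbit of a directed edge under \<open>U\<close> is determined by the side of its
  origin and the orbits of its two end colours. Transitivity of \<open>P j\<close> makes one of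
  these orbits automatic; the other colour is matched exactly inside the target.\<close>

lemma half_into_half:
  assumes trans: "perm_transitive (C j) (P j)" and ab: "E a b" and "E a' b'"
  obtains u where "u \<in> U" "u ` half a b \<subseteq> half a' b'"
proof -
  have "\<exists>p q \<tau> \<sigma>. E p q \<and> half p q \<subseteq> half a' b' \<and> side p = side a \<and>
    \<tau> \<in> P (\<not> side a) \<and> \<tau> (t a) = t p \<and> \<sigma> \<in> P (side a) \<and> \<sigma> (t b) = t q"
  proof (cases "side a = j")
    case True
    then obtain p q where pq: "E p q" "side p = j" "t p = t a" "half p q \<subseteq> half a' b'"
      using half_contains_colour[OF \<open>E a' b'\<close>, of "t a" j] colour_in'[of a] by blast
    moreover have "t b \<in> C j" "t q \<in> C j"
      using colour_in[OF ab] colour_in[OF pq(1)] True pq(2) by simp_all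
    then obtain \<sigma> where "\<sigma> \<in> P (side a)" "\<sigma> (t b) = t q"
      using trans True unfolding perm_transitive_def by blast
    moreover have "(\<lambda>x\<in>C (\<not> side a). x) (t a) = t p"
      using pq(3) colour_in'[of a] by simp
    ultimately show ?thesis
      using P_one[of "\<not> side a"] True by metis
  next
    case False
    then have j: "side a \<longleftrightarrow> \<not> j" by blast
    \<comment> \<open>Any colour except \<open>t b\<close>: the neighbour \<open>p'\<close> of
      \<open>q\<close> with colour \<open>t b\<close> then differs from \<open>p\<close>, so
      \<open>half q p'\<close> lies inside \<open>half p q\<close>.\<close>
    obtain x where x: "x \<in> C (\<not> j)" "x \<noteq> t b"
      using two_colours[of "\<not> j"] by metis
    then obtain p q where pq: "E p q" "side p = j" "t p = x" "half p q \<subseteq> half a' b'"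
      using half_contains_colour[OF \<open>E a' b'\<close> x(1)] by blast
    have sq: "side q = side a"
      using side_adj[OF pq(1)] pq(2) j by simp
    then obtain p' where p': "E q p'" "t p' = t b"
      using neighbour_of_colour[of "t b" q] colour_in[OF ab] by auto
    then have "half q p' \<subseteq> half a' b'"
      using half_next[OF pq(1) p'(1)] x(2) pq(3,4) by auto
    moreover obtain \<tau> where "\<tau> \<in> P (\<not> side a)" "\<tau> (t a) = t q"
      using trans colour_in'[of a] colour_in'[of q] sq j unfolding perm_transitive_def by auto
    moreover have "(\<lambda>x\<in>C (side a). x) (t b) = t p'"
      using p'(2) colour_in[OF ab] by simp
    ultimately show ?thesis
      using P_one[of "side a"] p'(1) sq by metis
  qed
  then obtain p q \<tau> \<sigma> where pq: "E p q" "half p q \<subseteq> half a' b'" "side p = side a"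
    and \<tau>: "\<tau> \<in> P (\<not> side a)" "\<tau> (t a) = t p" and \<sigma>: "\<sigma> \<in> P (side a)" "\<sigma> (t b) = t q"
    by blast
  obtain u where u: "u \<in> U" "u a = p" "\<And>y. E a y \<Longrightarrow> t (u y) = \<sigma> (t y)"
    using U_extend[OF pq(3) \<tau> \<sigma>(1)] by blast
  have "u b = q"
    using colour_inj[of p "u b" q] U_adj[OF u(1), of a b] u(2) u(3)[OF ab] ab pq(1) \<sigma>(2) by simp
  then show thesis
    using that[OF u(1)] U_half[OF u(1)] u(2) pq(2) by simp
qed

text \<open>If side \<open>i\<close> were fixed pointwise, a vertex of the other side and its image
  would share two neighbours, which in a tree forces them to coincide. This starts the displacement
  argument and later gives faithfulness of the action on one side.\<close>

lemma moved_vertex: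
  assumes "h \<in> U" "h \<noteq> id"
  obtains v where "side v = i" "h v \<noteq> v"
proof (rule ccontr)
  assume "\<not> thesis"
  then have fixed: "h v = v" if "side v = i" for v
    using that \<open>\<And>v. side v = i \<Longrightarrow> h v \<noteq> v \<Longrightarrow> thesis\<close> by blast
  have "h x = x" for x
  proof (rule ccontr)
    assume "h x \<noteq> x"
    obtain y z where yz: "E x y" "E x z" "z \<noteq> y"
      using another_neighbour by metis
    have "side x \<noteq> i"
      using fixed \<open>h x \<noteq> x\<close> by blast
    then have "h y = y" "h z = z"
      using fixed side_adj yz by metis+
    then have adj: "E (h x) y" "E (h x) z"
      using U_adj[OF assms(1), of x y] U_adj[OF assms(1), of x z] yz by simp_all
    then have "h x \<in> half x y"
      using half_closed[OF yz(1) half_root sym] \<open>h x \<noteq> x\<close> by blast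
    then have "z \<in> half x y"
      using half_closed[OF yz(1) _ adj(2)] adj_neq[OF yz(2)] by blast
    then show False
      using branch_unique yz by blast
  qed
  with assms(2) show False by auto
qed

text \<open>At a moved vertex \<open>v\<close>, a branch that points away from \<open>h v\<close>
  and whose image points away from \<open>v\<close> is disjoint from its image.\<close>

lemma half_displaced:
  assumes h: "h \<in> U" "h \<noteq> id"
    and three: "x \<in> C i" "y \<in> C i" "z \<in> C i" "x \<noteq> y" "x \<noteq> z" "y \<noteq> z"
  obtains v w where "E v w" "side v = i" "half v w \<inter> h ` half v w = {}"
proof -
  obtain v where v: "side v = i" "h v \<noteq> v"
    using moved_vertex[OF h] by blast
  obtain p where p: "E v p" "h v \<in> half v p"
    using branch_exists[OF v(2)] by blast
  obtain q where q: "E (h v) q" "v \<in> half (h v) q"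
    using branch_exists[of v "h v"] v(2) by metis
  \<comment> \<open>Two colours are excluded, those of the direction from \<open>v\<close> to
    \<open>h v\<close> and of the preimage of the direction from \<open>h v\<close> back to
    \<open>v\<close>; hence three colours.\<close>
  obtain a where a: "a \<in> C i" "a \<noteq> t p" "a \<noteq> t (inv_perm h q)"
    using three by metis
  obtain w where w: "E v w" "t w = a"
    using neighbour_of_colour[of a v] a(1) v(1) by blast
  have "w \<noteq> p" "h w \<noteq> q"
    using a(2,3) w(2) U_inv_apply(1)[OF h(1), of w] by auto
  have "h v \<notin> half v w"
    using branches_disjoint[OF w(1) p(1) \<open>w \<noteq> p\<close>] p(2) by blast
  then have "half v w \<subseteq> half (h v) q"
    using half_subset[OF w(1) q] by blast
  moreover have "E (h v) (h w)"
    using w U_adj h(1) by blast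
  ultimately have "half v w \<inter> h ` half v w = {}"
    using branches_disjoint[OF q(1) \<open>E (h v) (h w)\<close>] \<open>h w \<noteq> q\<close> U_half[OF h(1)] by auto
  with that w(1) v(1) show thesis by blast
qed

text \<open>On two points a permutation fixing one of them is the identity, so a group generated by
  point stabilisers would be trivial.\<close>

lemma three_colours:
  assumes gen: "gen_by_point_stabilisers (C i) (P i)" and nontriv: "perm_nontrivial (C i) (P i)"
  obtains x y z where "x \<in> C i" "y \<in> C i" "z \<in> C i" "x \<noteq> y" "x \<noteq> z" "y \<noteq> z"
proof (rule ccontr)
  assume "\<not> thesis"
  then have few: False if "x \<in> C i" "y \<in> C i" "z \<in> C i" "x \<noteq> y" "x \<noteq> z" "y \<noteq> z" for x y z
    using that \<open>\<And>x y z. \<lbrakk>x \<in> C i; y \<in> C i; z \<in> C i; x \<noteq> y; x \<noteq> z; y \<noteq> z\<rbrakk> \<Longrightarrow> thesis\<close> by blast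
  interpret G: group "BijGroup (C i)"
    by (rule group_BijGroup)
  have "g = \<one>\<^bsub>BijGroup (C i)\<^esub>" if "g \<in> point_stabiliser (C i) (P i) x" "x \<in> C i" for g x
  proof -
    have g: "g \<in> P i" "g x = x"
      using that by (auto simp: point_stabiliser_def)
    have "g y = y" if "y \<in> C i" for y
    proof (rule ccontr)
      assume "g y \<noteq> y"
      then have "y \<noteq> x" "g y \<noteq> x"
        using g(2) P_bij[OF g(1)] \<open>x \<in> C i\<close> that by (auto simp: bij_betw_def dest: inj_onD)
      then show False
        using few[of x y "g y"] P_closed[OF g(1)] \<open>x \<in> C i\<close> that \<open>g y \<noteq> y\<close> by metis
    qed
    then have "g = (\<lambda>x\<in>C i. x)"
      using P_ext[OF g(1)] by (intro extensionalityI[of _ "C i"]) auto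
    then show ?thesis
      by (simp add: BijGroup_def)
  qed
  then have "(\<Union>x\<in>C i. point_stabiliser (C i) (P i) x) \<subseteq> {\<one>\<^bsub>BijGroup (C i)\<^esub>}"
    by blast
  then have "generate (BijGroup (C i)) (\<Union>x\<in>C i. point_stabiliser (C i) (P i) x) \<subseteq> {\<one>\<^bsub>BijGroup (C i)\<^esub>}"
    using G.generate_subgroup_incl G.triv_subgroup by blast
  then have "P i \<subseteq> {\<one>\<^bsub>BijGroup (C i)\<^esub>}"
    using gen unfolding gen_by_point_stabilisers_def by blast
  then show False
    using nontriv subgroup.one_closed[OF perm[of i]] unfolding perm_nontrivial_def by blast
qed

text \<open>Tits' independence property for edges.\<close>
lemma U_restrict_half:
  assumes "g \<in> U" "E a b" "g a = a" "g b = b"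
  shows "(\<lambda>x. if x \<in> half a b then g x else x) \<in> U"
proof (rule U_locally)
  fix x
  let ?k = "\<lambda>x. if x \<in> half a b then g x else x"
  show "\<exists>u\<in>U. u x = ?k x \<and> (\<forall>y. E x y \<longrightarrow> u y = ?k y)"
  \<comment> \<open>The only edge across the boundary is \<open>(b, a)\<close> and \<open>g\<close>
    fixes both ends, so around each vertex the map agrees with \<open>g\<close> or with
    \<open>id\<close>.\<close>
  proof (cases "x \<in> half a b")
    case True
    then show ?thesis
      using half_crossing[OF assms(2) _ True] assms by (intro bexI[of _ g]) auto
  next
    case False
    have "?k y = y" if "E x y" for y
      using half_crossing[OF assms(2) sym[OF that] _ False] assms(4) by auto
    then show ?thesis
      using False U_id by (intro bexI[of _ id]) auto
  qed
qed

end

section \<open>Normal subgroups of the universal group\<close>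

text \<open>Normality is spelled out through composition and \<open>inv_perm\<close>, so that the
  geometric arguments involve no group records.\<close>

locale normal_part = coloured_tree E side t C P
  for E :: "'v \<Rightarrow> 'v \<Rightarrow> bool" and side and t :: "'v \<Rightarrow> 'a" and C P +
  fixes H :: "('v \<Rightarrow> 'v) set"
  assumes H_sub: "H \<subseteq> U"
    and H_id: "id \<in> H"
    and H_comp: "g \<in> H \<Longrightarrow> h \<in> H \<Longrightarrow> g \<circ> h \<in> H"
    and H_inv: "g \<in> H \<Longrightarrow> inv_perm g \<in> H"
    and H_conj: "u \<in> U \<Longrightarrow> g \<in> H \<Longrightarrow> u \<circ> g \<circ> inv_perm u \<in> H"
begin

text \<open>With \<open>q = \<Prod>n. k\<^sup>n g k\<^sup>-\<^sup>n\<close>, an infinite product of elements with disjoint supports, \<open>g\<close> is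
  the commutator of \<open>q\<close> and \<open>k\<close>.\<close>
lemma supported_in_displaced_half:
  assumes k: "k \<in> H" and ab: "E a b"
    and D: "k ` D \<subseteq> D" "half a b \<subseteq> D" "half a b \<inter> k ` D = {}"
    and g: "g \<in> U" "\<And>x. x \<notin> half a b \<Longrightarrow> g x = x"
  shows "g \<in> H"
proof -
  define B where "B = half a b"
  have kU: "k \<in> U"
    using k H_sub by blast
  have kn: "k ^^ n \<in> U" for n
  proof (induction n)
    case 0
    show ?case using U_id by (simp only: funpow.simps)
  next
    case (Suc n)
    then show ?case using U_comp[OF kU] by (simp only: funpow.simps)
  qed
  have kn_D: "(k ^^ n) ` D \<subseteq> D" for n
    by (induction n) (use D(1) in auto)
  \<comment> \<open>\<open>D\<close> acts as a trap: all later translates of \<open>B\<close> lie in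
    the image of \<open>D\<close> under \<open>k\<close>, which misses \<open>B\<close>.\<close>
  have disj0: "(k ^^ Suc n) ` B \<inter> B = {}" for n
  proof -
    have "(k ^^ Suc n) ` B = k ` (k ^^ n) ` B"
      by (simp add: image_comp)
    also have "\<dots> \<subseteq> k ` D"
      using kn_D[of n] D(2) unfolding B_def by blast
    finally show ?thesis
      using D(3) unfolding B_def by blast
  qed
  have disj: "n = m" if x: "x \<in> (k ^^ n) ` B" "x \<in> (k ^^ m) ` B" for n m x
  proof -
    have False if "n < m" "x \<in> (k ^^ n) ` B" "x \<in> (k ^^ m) ` B" for n m
    proof -
      obtain i where "m = n + Suc i"
        using \<open>n < m\<close> less_imp_Suc_add by (metis add_Suc_right)
      then have "k ^^ m = (k ^^ n) \<circ> (k ^^ Suc i)"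
        by (simp only: funpow_add)
      then have "x \<in> (k ^^ n) ` (k ^^ Suc i) ` B"
        using that(3) by (simp only: image_comp)
      with that(2) show False
        using disj0[of i] U_eq_iff[OF kn[of n]] by blast
    qed
    with x show ?thesis
      by (metis linorder_neqE_nat)
  qed
  define gn where "gn n = (k ^^ n) \<circ> g \<circ> inv_perm (k ^^ n)" for n
  have gnU: "gn n \<in> U" for n
    unfolding gn_def by (intro U_comp U_inv kn g(1))
  have gn_apply: "gn n ((k ^^ n) x) = (k ^^ n) (g x)" for n x
    by (simp add: gn_def kn)
  have gn_fix: "gn n x = x" if "x \<notin> (k ^^ n) ` B" for n x
  proof -
    have "inv_perm (k ^^ n) x \<notin> B"
      using that U_inv_apply(2)[OF kn] by (metis imageI)
    then show ?thesis
      using g(2) kn by (simp add: gn_def B_def)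
  qed
  have gB: "g x \<in> B" if "x \<in> B" for x
    using that g(2)[of "g x"] U_eq_iff[OF g(1)] unfolding B_def by metis
  have gb: "g b = b"
  proof -
    have "g a = a"
      using g(2) half_not_base[OF ab] by blast
    then have "E a (g b)"
      using U_adj[OF g(1), of a b] ab by simp
    then show ?thesis
      using branch_unique[OF ab] gB half_root unfolding B_def by blast
  qed
  \<comment> \<open>At most one translate of \<open>B\<close> contains a given vertex, so the
    infinite product has at most one active factor there.\<close>
  define q where "q x = (if \<exists>n. x \<in> (k ^^ n) ` B then gn (THE n. x \<in> (k ^^ n) ` B) x else x)" for x
  have q_in: "q x = gn n x" if "x \<in> (k ^^ n) ` B" for x n
  proof -
    have "(THE n. x \<in> (k ^^ n) ` B) = n"
      using that disj by blast
    then show ?thesis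
      using that by (auto simp: q_def)
  qed
  have q_out: "q x = x" if "\<And>n. x \<notin> (k ^^ n) ` B" for x
    using that by (simp add: q_def)
  have kn_B: "(k ^^ n) ` B = half ((k ^^ n) a) ((k ^^ n) b)" for n
    unfolding B_def by (rule U_half[OF kn])
  have kn_adj: "E ((k ^^ n) a) ((k ^^ n) b)" for n
    using U_adj[OF kn] ab by simp
  have kn_b: "gn n ((k ^^ n) b) = (k ^^ n) b" for n
    using gn_apply gb by simp
  \<comment> \<open>Translates may be adjacent, but the neighbour is then the root of its translate,
    which its own factor fixes. So around a vertex of the translate with index \<open>n\<close> the
    map \<open>q\<close> agrees with \<open>gn n\<close>.\<close>
  have q_boundary: "q y = y"
    if "E x y" "x \<in> (k ^^ n) ` B" "y \<notin> (k ^^ n) ` B" for x y n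
  proof (cases "\<exists>m. y \<in> (k ^^ m) ` B")
    case True
    then obtain m where m: "y \<in> (k ^^ m) ` B" by blast
    then have "m \<noteq> n"
      using that(3) by blast
    then have "x \<notin> (k ^^ m) ` B"
      using that(2) disj by blast
    then have "y = (k ^^ m) b"
      using half_crossing[OF kn_adj[of m] sym[OF that(1)]] m unfolding kn_B by blast
    then show ?thesis
      using q_in[OF m] kn_b by simp
  qed (use q_out in blast)
  have "q \<in> U"
  proof (rule U_locally)
    fix x
    show "\<exists>u\<in>U. u x = q x \<and> (\<forall>y. E x y \<longrightarrow> u y = q y)"
    proof (cases "\<exists>n. x \<in> (k ^^ n) ` B")
      case True
      then obtain n where n: "x \<in> (k ^^ n) ` B" by blast
      have "gn n y = q y" if "E x y" for y
        using q_in[of y n] q_boundary[OF that n] gn_fix by metis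
      then show ?thesis
        using gnU q_in[OF n] by (metis (no_types, lifting))
    next
      case False
      have "q y = y" if "E x y" for y
      proof (cases "\<exists>m. y \<in> (k ^^ m) ` B")
        case True
        then obtain m where m: "y \<in> (k ^^ m) ` B" by blast
        then have "y = (k ^^ m) b"
          using half_crossing[OF kn_adj[of m] sym[OF that]] False unfolding kn_B by blast
        then show ?thesis
          using q_in[OF m] kn_b by simp
      qed (use q_out in blast)
      then show ?thesis
        using False q_out U_id by (intro bexI[of _ id]) auto
    qed
  qed
  \<comment> \<open>Conjugation by \<open>k\<close> shifts the factors of \<open>q\<close> by one
    and so omits the first, which is \<open>g\<close>; thus \<open>q\<close> is \<open>g\<close>
    times its conjugate.\<close>
  have comm: "q (k x) = g (k (q x))" for x
  proof (cases "\<exists>n. x \<in> (k ^^ n) ` B")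
    case True
    then obtain n z where z: "z \<in> B" "x = (k ^^ n) z" by blast
    have "q x = (k ^^ n) (g z)"
      using q_in[of x n] z gn_apply by simp
    then have kq: "k (q x) = (k ^^ Suc n) (g z)" by simp
    then have "k (q x) \<in> (k ^^ Suc n) ` B"
      using gB[OF z(1)] by blast
    then have "k (q x) \<notin> B"
      using disj0[of n] by blast
    then have "g (k (q x)) = (k ^^ Suc n) (g z)"
      using g(2) kq unfolding B_def by simp
    moreover have "k x = (k ^^ Suc n) z"
      using z by simp
    moreover have "q ((k ^^ Suc n) z) = (k ^^ Suc n) (g z)"
      by (rule trans[OF q_in[OF imageI[OF z(1)]] gn_apply])
    ultimately show ?thesis by simp
  next
    case False
    then have "q x = x"
      using q_out by blast
    have *: "k x \<notin> (k ^^ Suc n) ` B" for n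
      using False U_eq_iff[OF kU] by (auto simp: image_iff)
    show ?thesis
    proof (cases "k x \<in> B")
      case True
      then have "q (k x) = gn 0 (k x)"
        by (intro q_in) simp
      also have "\<dots> = g (k x)"
        using gn_apply[of 0 "k x"] by simp
      finally show ?thesis
        using \<open>q x = x\<close> by simp
    next
      case False
      then have "k x \<notin> (k ^^ n) ` B" for n
        using * by (cases n) auto
      then show ?thesis
        using q_out g(2) False \<open>q x = x\<close> by (simp add: B_def)
    qed
  qed
  have "g = (q \<circ> k \<circ> inv_perm q) \<circ> inv_perm k"
  proof
    fix x
    show "g x = ((q \<circ> k \<circ> inv_perm q) \<circ> inv_perm k) x"
      using comm[of "inv_perm q (inv_perm k x)"] \<open>q \<in> U\<close> kU by simp
  qed
  then show ?thesis
    using H_comp[OF H_conj[OF \<open>q \<in> U\<close> k] H_inv[OF k]] by simp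
qed

lemma HU: "h \<in> H \<Longrightarrow> h \<in> U"
  using H_sub by blast

text \<open>In other terms, \<open>H\<close> contains the rigid stabiliser of the half-tree.\<close>

definition supports_in_H :: "'v \<Rightarrow> 'v \<Rightarrow> bool" where
  "supports_in_H a b \<longleftrightarrow> (\<forall>g\<in>U. (\<forall>x. x \<notin> half a b \<longrightarrow> g x = x) \<longrightarrow> g \<in> H)"

lemma supports_in_H_transport:
  assumes "supports_in_H a b" "u \<in> U" "half a' b' \<subseteq> u ` half a b"
  shows "supports_in_H a' b'"
  unfolding supports_in_H_def
proof (intro ballI impI)
  fix g assume g: "g \<in> U" "\<forall>x. x \<notin> half a' b' \<longrightarrow> g x = x"
  let ?g = "inv_perm u \<circ> g \<circ> u"
  have "?g x = x" if "x \<notin> half a b" for x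
  proof -
    have "u x \<notin> half a' b'"
      using that assms(3) U_eq_iff[OF assms(2)] by (metis imageE subsetD)
    then show ?thesis
      using g(2) assms(2) by simp
  qed
  moreover have "?g \<in> U"
    by (intro U_comp U_inv g(1) assms(2))
  ultimately have "?g \<in> H"
    using assms(1) unfolding supports_in_H_def by blast
  then have "u \<circ> ?g \<circ> inv_perm u \<in> H"
    using H_conj assms(2) by blast
  moreover have "u \<circ> ?g \<circ> inv_perm u = g"
    using assms(2) by (simp add: fun_eq_iff)
  ultimately show "g \<in> H" by simp
qed

text \<open>Since \<open>f\<close> moves some \<open>half v w\<close> off itself, take disjoint
  \<open>half z y1\<close> and \<open>half z y2\<close> inside it. A conjugate \<open>h\<close> of
  \<open>f\<close> sends the complement \<open>D\<close> of \<open>half z y2\<close> into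
  \<open>half z y2\<close>, which \<open>f\<close> sends off \<open>half v w\<close>. So
  \<open>k = f \<circ> h\<close> maps \<open>D\<close> into itself and off \<open>half z y1\<close>;
  the commutator argument applies there, and conjugation carries the result to every
  half-tree.\<close>

lemma supports_in_H_all:
  assumes trans: "perm_transitive (C j) (P j)" and f: "f \<in> H" "f \<noteq> id"
    and three: "x1 \<in> C i" "x2 \<in> C i" "x3 \<in> C i" "x1 \<noteq> x2" "x1 \<noteq> x3" "x2 \<noteq> x3"
    and "E a b"
  shows "supports_in_H a b"
proof -
  obtain v w where vw: "E v w" "side v = i" "half v w \<inter> f ` half v w = {}"
    using half_displaced[OF HU[OF f(1)] f(2) three] by blast
  obtain z where z: "E w z" "z \<noteq> v"
    using another_neighbour by blast
  have "side z = i"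
    using side_adj[OF z(1)] side_adj[OF vw(1)] vw(2) by simp
  obtain y1 where y1: "E z y1" "y1 \<noteq> w"
    using another_neighbour by blast
  \<comment> \<open>Three colours leave room at \<open>z\<close> for two branches besides the one
    back to \<open>w\<close>.\<close>
  obtain c where "c \<in> C i" "c \<noteq> t w" "c \<noteq> t y1"
    using three by metis
  moreover obtain y2 where "E z y2" "t y2 = c"
    using neighbour_of_colour[of c z] \<open>c \<in> C i\<close> \<open>side z = i\<close> by blast
  ultimately have y2: "E z y2" "y2 \<noteq> w" "y2 \<noteq> y1"
    by auto
  have sub: "half z y1 \<subseteq> half v w" "half z y2 \<subseteq> half v w"
    using half_next[OF z(1) y1] half_next[OF z(1) y2(1,2)] half_next[OF vw(1) z] by blast+
  have disj: "half z y1 \<inter> half z y2 = {}"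
    using branches_disjoint[OF y1(1) y2(1)] y2(3) by blast
  define D where "D = half y2 z"
  have D: "D = - half z y2"
    unfolding D_def by (rule half_opposite[OF y2(1)])
  \<comment> \<open>Squeezing the complement of \<open>half v w\<close> into
    \<open>half z y2\<close> makes the image of \<open>half v w\<close> cover \<open>D\<close>, so
    the conjugate of \<open>f\<close> by \<open>u\<close> displaces \<open>D\<close>.\<close>
  obtain u where u: "u \<in> U" "u ` half w v \<subseteq> half z y2"
    using half_into_half[OF trans sym[OF vw(1)] y2(1)] by blast
  have "half w v = - half v w"
    by (rule half_opposite[OF vw(1)])
  then have uD: "D \<subseteq> u ` half v w"
    using u(2) D bij_image_Compl_eq[OF U_bij[OF u(1)], of "half v w"] by auto
  define h where "h = u \<circ> f \<circ> inv_perm u"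
  have h: "h \<in> H"
    unfolding h_def using H_conj u(1) f(1) by blast
  have hD: "h ` D \<subseteq> half z y2"
  proof -
    have "h x \<notin> D" if "x \<in> D" for x
    proof
      assume "h x \<in> D"
      obtain x' x'' where x: "x' \<in> half v w" "x = u x'" "x'' \<in> half v w" "h x = u x''"
        using uD \<open>x \<in> D\<close> \<open>h x \<in> D\<close> by blast
      then have "f x' = x''"
        using U_eq_iff[OF u(1)] u(1) by (simp add: h_def)
      with x vw(3) show False by blast
    qed
    then show ?thesis
      using D by blast
  qed
  define k where "k = f \<circ> h"
  have kH: "k \<in> H"
    unfolding k_def by (rule H_comp[OF f(1) h])
  have "k ` D \<subseteq> f ` half z y2"
    using hD unfolding k_def by auto
  also have "\<dots> \<subseteq> f ` half v w"
    using sub(2) by (rule image_mono)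
  finally have kD: "k ` D \<subseteq> - half v w"
    using vw(3) by blast
  then have D_props: "k ` D \<subseteq> D" "half z y1 \<subseteq> D" "half z y1 \<inter> k ` D = {}"
    using D sub disj by blast+
  have "supports_in_H z y1"
    unfolding supports_in_H_def
  proof (intro ballI impI)
    fix g assume "g \<in> U" "\<forall>x. x \<notin> half z y1 \<longrightarrow> g x = x"
    then show "g \<in> H"
      using supported_in_displaced_half[OF kH y1(1) D_props] by blast
  qed
  \<comment> \<open>Used for the opposite half-trees: passing to complements turns the inclusion
    into the covering needed for the transport.\<close>
  obtain u' where u': "u' \<in> U" "u' ` half y1 z \<subseteq> half b a"
    using half_into_half[OF trans sym[OF y1(1)] sym[OF \<open>E a b\<close>]] by blast
  then have "half a b \<subseteq> u' ` half z y1"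
    using half_opposite[OF y1(1)] half_opposite[OF \<open>E a b\<close>]
      bij_image_Compl_eq[OF U_bij[OF u'(1)], of "half z y1"] by auto
  then show ?thesis
    using supports_in_H_transport[OF \<open>supports_in_H z y1\<close> u'(1)] by blast
qed

end

section \<open>From half-trees to stabilisers and to the whole group\<close>

locale full_normal_part = normal_part +
  assumes supports: "E a b \<Longrightarrow> supports_in_H a b"
    and gen: "gen_by_point_stabilisers (C i) (P i)"
begin

text \<open>By independence \<open>g\<close> is the product of its restrictions to the two
  half-trees of the edge.\<close>

lemma edge_stabiliser:
  assumes "g \<in> U" "E a b" "g a = a" "g b = b"
  shows "g \<in> H"
proof -
  let ?g1 = "\<lambda>x. if x \<in> half a b then g x else x"
  let ?g2 = "\<lambda>x. if x \<in> half b a then g x else x"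
  have "?g1 \<in> H"
    using supports[OF assms(2)] U_restrict_half[OF assms] unfolding supports_in_H_def by simp
  moreover have "?g2 \<in> H"
    using supports[OF sym[OF assms(2)]] U_restrict_half[OF assms(1) sym[OF assms(2)] assms(4,3)]
    unfolding supports_in_H_def by simp
  moreover have "?g1 \<circ> ?g2 = g"
  proof
    fix x
    have "g x \<in> half b a" if "x \<in> half b a" for x
      using that U_half[OF assms(1), of b a] assms(3,4) by auto
    then show "(?g1 \<circ> ?g2) x = g x"
      using half_opposite[OF assms(2)] by auto
  qed
  ultimately show ?thesis
    using H_comp by metis
qed

text \<open>A permutation fixing a colour extends to an element fixing an edge at \<open>v\<close>,
  hence to one in \<open>H\<close>. Permutations realised in this way are closed under composition,
  so generation by point stabilisers yields all of \<open>P (side v)\<close>.\<close>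

lemma local_action_in_H:
  assumes "\<sigma> \<in> P (side v)"
  obtains h where "h \<in> H" "h v = v" "\<And>y. E v y \<Longrightarrow> t (h y) = \<sigma> (t y)"
proof -
  let ?S = "\<Union>x\<in>C (side v). point_stabiliser (C (side v)) (P (side v)) x"
  have stab: "\<exists>h\<in>H. h v = v \<and> (\<forall>y. E v y \<longrightarrow> t (h y) = \<sigma> (t y))"
    if \<sigma>: "\<sigma> \<in> P (side v)" and x: "x \<in> C (side v)" "\<sigma> x = x" for \<sigma> x
  proof -
    obtain u where u: "u \<in> U" "u v = v" "\<And>y. E v y \<Longrightarrow> t (u y) = \<sigma> (t y)"
      using U_extend_fixing[OF \<sigma>] by blast
    obtain y where y: "E v y" "t y = x"
      using neighbour_of_colour[OF x(1)] by blast
    have "u y = y"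
      using colour_inj[of v "u y" y] U_adj[OF u(1), of v y] u(2) u(3)[OF y(1)] y x(2) by simp
    then have "u \<in> H"
      using edge_stabiliser[OF u(1) y(1) u(2)] by blast
    with u show ?thesis by blast
  qed
  have "P (side v) = generate (BijGroup (C (side v))) ?S"
    using gen unfolding gen_by_point_stabilisers_def by blast
  then have "\<sigma> \<in> generate (BijGroup (C (side v))) ?S"
    using assms by blast
  then have "\<exists>h\<in>H. h v = v \<and> (\<forall>y. E v y \<longrightarrow> t (h y) = \<sigma> (t y))"
  proof (induction rule: generate.induct)
    case one
    show ?case
      using H_id by (intro bexI[of _ id]) (simp_all add: BijGroup_def colour_in)
  next
    case (incl \<sigma>)
    then show ?case
      using stab by (auto simp: point_stabiliser_def)
  next
    case (inv \<sigma>)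
    then obtain x where x: "\<sigma> \<in> P (side v)" "x \<in> C (side v)" "\<sigma> x = x"
      by (auto simp: point_stabiliser_def)
    have eq: "inv\<^bsub>BijGroup (C (side v))\<^esub> \<sigma> = (\<lambda>x\<in>C (side v). inv_into (C (side v)) \<sigma> x)"
      using P_bij[OF x(1)] P_ext[OF x(1)] by (intro inv_BijGroup) (simp add: Bij_def)
    have "inv_into (C (side v)) \<sigma> x = x"
      using x P_bij[OF x(1)] by (metis bij_betw_def inv_into_f_f)
    then show ?case
      unfolding eq using stab[OF P_inv[OF x(1)] x(2)] x(2) by simp
  next
    case (eng \<sigma> \<tau>)
    then have P: "\<sigma> \<in> P (side v)" "\<tau> \<in> P (side v)"
      using \<open>P (side v) = _\<close> by blast+
    obtain g h where gh: "g \<in> H" "g v = v" "\<forall>y. E v y \<longrightarrow> t (g y) = \<sigma> (t y)"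
      "h \<in> H" "h v = v" "\<forall>y. E v y \<longrightarrow> t (h y) = \<tau> (t y)"
      using eng.IH by blast
    have eq: "\<sigma> \<otimes>\<^bsub>BijGroup (C (side v))\<^esub> \<tau> = compose (C (side v)) \<sigma> \<tau>"
      using P P_bij P_ext by (simp add: BijGroup_def Bij_def)
    have "t ((g \<circ> h) y) = compose (C (side v)) \<sigma> \<tau> (t y)" if "E v y" for y
    proof -
      have "E v (h y)"
        using U_adj[OF HU[OF gh(4)], of v y] gh(5) that by simp
      then show ?thesis
        using gh that colour_in by (simp add: compose_eq)
    qed
    then show ?case
      unfolding eq using H_comp[OF gh(1,4)] gh(2,5) by (intro bexI[of _ "g \<circ> h"]) auto
  qed
  with that show thesis by blast
qed

text \<open>Divide \<open>g\<close> by an element of \<open>H\<close> with the same local action at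
  \<open>v\<close>; the quotient fixes an edge.\<close>

lemma vertex_stabiliser:
  assumes "g \<in> U" "g v = v"
  shows "g \<in> H"
proof -
  obtain \<sigma> where \<sigma>: "\<sigma> \<in> P (side v)" "\<And>w. E v w \<Longrightarrow> t (g w) = \<sigma> (t w)"
    using U_local_action[OF assms(1)] by blast
  obtain h where h: "h \<in> H" "h v = v" "\<And>y. E v y \<Longrightarrow> t (h y) = \<sigma> (t y)"
    using local_action_in_H[OF \<sigma>(1)] by blast
  obtain y where y: "E v y"
    using another_neighbour by blast
  have "g y = h y"
    using colour_inj[of v "g y" "h y"] \<sigma>(2)[OF y] h(3)[OF y] y
      U_adj[OF assms(1), of v y] U_adj[OF HU[OF h(1)], of v y] assms(2) h(2) by simp
  let ?k = "inv_perm h \<circ> g"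
  have hU: "h \<in> U"
    by (rule HU[OF h(1)])
  have "?k v = v" "?k y = y"
    using U_inv_apply(1)[OF hU, of v] U_inv_apply(1)[OF hU, of y] \<open>g y = h y\<close> h(2) assms(2) by simp_all
  then have "?k \<in> H"
    using edge_stabiliser[OF U_comp[OF U_inv[OF hU] assms(1)] y] by blast
  then have "h \<circ> ?k \<in> H"
    using H_comp h(1) by blast
  moreover have "h \<circ> ?k = g"
    using hU by (simp add: fun_eq_iff)
  ultimately show ?thesis by simp
qed

text \<open>Local actions at vertices of side \<open>j\<close> make \<open>H\<close> transitive on
  the other side, and \<open>H\<close> contains the stabilisers there.\<close>

lemma H_eq_U:
  assumes trans: "perm_transitive (C j) (P j)"
  shows "H = U"
proof
  show "U \<subseteq> H"
  proof
    fix g assume g: "g \<in> U"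
    obtain r where r: "side r \<noteq> j"
      using another_neighbour[of undefined] side_adj by (metis (full_types))
    have nbrs: "\<exists>h\<in>H. h y = z" if x: "side x = j" and y: "E x y" and z: "E x z" for x y z
    proof -
      obtain \<sigma> where \<sigma>: "\<sigma> \<in> P (side x)" "\<sigma> (t y) = t z"
        using trans colour_in[OF y] colour_in[OF z]
        unfolding perm_transitive_def x by blast
      obtain h where h: "h \<in> H" "h x = x" "\<And>y. E x y \<Longrightarrow> t (h y) = \<sigma> (t y)"
        using local_action_in_H[OF \<sigma>(1)] by blast
      have "h y = z"
        using colour_inj[of x "h y" z] h(3)[OF y] \<sigma>(2) y z h(2)
          U_adj[OF HU[OF h(1)], of x y] by simp
      with h(1) show ?thesis by blast
    qed
    \<comment> \<open>Induction along a walk from \<open>r\<close>: a vertex of side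
      \<open>j\<close> is outside the orbit, so there the claim concerns all its neighbours
      instead.\<close>
    have "if side x = j then \<forall>y. E x y \<longrightarrow> (\<exists>h\<in>H. h r = y) else \<exists>h\<in>H. h r = x" for x
      using connected[of r x]
    proof (induction rule: rtranclp_induct)
      case base
      show ?case
        using r H_id by (auto intro: bexI[of _ id])
    next
      case (step x y)
      show ?case
      proof (cases "side x = j")
        case True
        then show ?thesis
          using step side_adj[OF step.hyps(2)] by auto
      next
        case False
        then obtain h where h: "h \<in> H" "h r = x"
          using step.IH by auto
        have "\<exists>h\<in>H. h r = z" if z: "E y z" for z
        proof -
          obtain h' where "h' \<in> H" "h' x = z"
            using nbrs[of y x z] z sym[OF step.hyps(2)] side_adj[OF step.hyps(2)] False by auto
          then show ?thesis
            using H_comp[of h' h] h by (intro bexI[of _ "h' \<circ> h"]) auto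
        qed
        then show ?thesis
          using side_adj[OF step.hyps(2)] False by auto
      qed
    qed
    from this[of "g r"] obtain h where h: "h \<in> H" "h r = g r"
      using r U_side[OF g] by auto
    then have hU: "h \<in> U"
      using HU by blast
    have "(inv_perm h \<circ> g) r = r"
      using U_inv_apply(1)[OF hU, of r] h(2) by simp
    then have "inv_perm h \<circ> g \<in> H"
      using vertex_stabiliser[OF U_comp[OF U_inv[OF hU] g]] by blast
    then have "h \<circ> (inv_perm h \<circ> g) \<in> H"
      using H_comp h(1) by blast
    moreover have "h \<circ> (inv_perm h \<circ> g) = g"
      using hU by (simp add: fun_eq_iff)
    ultimately show "g \<in> H" by simp
  qed
qed (rule H_sub)

end

section \<open>Simplicity\<close>

text \<open>Normal subgroups of \<open>K\<close> pull back along \<open>h\<close> to normal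
  subgroups of \<open>G\<close>.\<close>

lemma is_simple_iso:
  assumes h: "h \<in> iso G K" and G: "group G" and K: "group K" and simple: "is_simple G"
  shows "is_simple K"
proof -
  interpret group_hom G K h
    using assms by (simp add: group_hom_def group_hom_axioms_def iso_def)
  have inj: "inj_on h (carrier G)" and surj: "h ` carrier G = carrier K"
    using h by (auto simp: iso_def bij_betw_def)
  have one: "{x \<in> carrier G. h x = \<one>\<^bsub>K\<^esub>} = {\<one>\<^bsub>G\<^esub>}"
    using inj by (auto dest: inj_onD[of h _ _ "\<one>\<^bsub>G\<^esub>"])
  have "carrier K \<noteq> {\<one>\<^bsub>K\<^esub>}"
    using one simple surj unfolding is_simple_def by auto
  moreover have "N = carrier K \<or> N = {\<one>\<^bsub>K\<^esub>}" if "N \<lhd> K" for N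
  proof -
    have N: "subgroup N K" "\<And>x n. x \<in> carrier K \<Longrightarrow> n \<in> N \<Longrightarrow> x \<otimes>\<^bsub>K\<^esub> n \<otimes>\<^bsub>K\<^esub> inv\<^bsub>K\<^esub> x \<in> N"
      using that group.normal_inv_iff[OF K] by auto
    let ?N = "{x \<in> carrier G. h x \<in> N}"
    have "subgroup ?N G"
      by (rule G.subgroupI)
        (use subgroup.one_closed[OF N(1)] subgroup.m_closed[OF N(1)] subgroup.m_inv_closed[OF N(1)]
          in \<open>auto intro: exI[of _ "\<one>\<^bsub>G\<^esub>"]\<close>)
    then have "?N \<lhd> G"
      using N(2) by (auto simp: G.normal_inv_iff)
    then have "?N = carrier G \<or> ?N = {\<one>\<^bsub>G\<^esub>}"
      using simple unfolding is_simple_def by blast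
    moreover have "N = h ` ?N"
      using subgroup.subset[OF N(1)] surj by auto
    ultimately show ?thesis
      using surj by auto
  qed
  ultimately show ?thesis
    using K unfolding is_simple_def by blast
qed

section \<open>The universal group as an abstract group\<close>

context coloured_tree
begin

definition UG :: "('v \<Rightarrow> 'v) monoid" where
  "UG = (BijGroup UNIV)\<lparr>carrier := U\<rparr>"

lemma U_subset_Bij: "U \<subseteq> Bij UNIV"
  using U_bij by (auto simp: Bij_def extensional_def)

lemma UG_simps:
  "carrier UG = U"
  "\<one>\<^bsub>UG\<^esub> = id"
  "g \<in> U \<Longrightarrow> h \<in> U \<Longrightarrow> g \<otimes>\<^bsub>UG\<^esub> h = g \<circ> h"
  using U_subset_Bij by (auto simp: UG_def BijGroup_def compose_def fun_eq_iff)

lemma group_UG: "group UG"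
proof (rule groupI)
  show "\<exists>h\<in>carrier UG. h \<otimes>\<^bsub>UG\<^esub> g = \<one>\<^bsub>UG\<^esub>" if "g \<in> carrier UG" for g
    using that U_inv by (intro bexI[of _ "inv_perm g"]) (auto simp: UG_simps fun_eq_iff)
qed (auto simp: UG_simps U_id U_comp comp_assoc)

lemma UG_inv: "g \<in> U \<Longrightarrow> inv\<^bsub>UG\<^esub> g = inv_perm g"
  by (rule group.inv_equality[OF group_UG]) (auto simp: UG_simps U_inv fun_eq_iff)

text \<open>The change of height is a nonzero homomorphism to the integers. Its kernel
  \<open>K\<close> is proper, and nontrivial because an element with a fixed vertex changes no
  height.\<close>

lemma not_simple_UG:
  assumes intrans: "\<And>i. \<not> perm_transitive (C i) (P i)" and nontriv: "perm_nontrivial (C i) (P i)"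
  shows "\<not> is_simple UG"
proof
  assume simple: "is_simple UG"
  obtain \<psi> :: "'v \<Rightarrow> int" where
    \<psi>: "\<And>g x y. g \<in> U \<Longrightarrow> \<psi> (g x) - \<psi> x = \<psi> (g y) - \<psi> y"
    and moving: "\<exists>g\<in>U. \<exists>x. \<psi> (g x) \<noteq> \<psi> x"
    using intransitive_height[OF intrans] by blast
  define K where "K = {g \<in> U. \<forall>x. \<psi> (g x) = \<psi> x}"
  have "\<psi> (inv_perm g x) = \<psi> x" if "g \<in> K" for g x
    using that U_inv_apply(2)[of g x] unfolding K_def by (metis (mono_tags, lifting) mem_Collect_eq)
  then have "subgroup K UG"
    by (intro group.subgroupI[OF group_UG])
      (auto simp: K_def UG_simps UG_inv U_inv U_comp U_id intro!: exI[of _ id])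
  moreover have "u \<circ> g \<circ> inv_perm u \<in> K" if u: "u \<in> U" and g: "g \<in> K" for u g
  proof -
    have "\<psi> (u (g (inv_perm u x))) = \<psi> x" for x
    proof -
      have "\<psi> (u (g (inv_perm u x))) - \<psi> (g (inv_perm u x)) = \<psi> (u (inv_perm u x)) - \<psi> (inv_perm u x)"
        by (rule \<psi>[OF u])
      moreover have "\<psi> (g (inv_perm u x)) = \<psi> (inv_perm u x)"
        using g by (simp add: K_def)
      ultimately show ?thesis
        using u by simp
    qed
    then show ?thesis
      using u g by (auto simp: K_def U_comp U_inv)
  qed
  then have "\<forall>x\<in>carrier UG. \<forall>g\<in>K. x \<otimes>\<^bsub>UG\<^esub> g \<otimes>\<^bsub>UG\<^esub> inv\<^bsub>UG\<^esub> x \<in> K"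
    by (auto simp: UG_simps UG_inv U_inv U_comp K_def)
  ultimately have "K \<lhd> UG"
    using group.normal_inv_iff[OF group_UG] by blast
  then have "K = U \<or> K = {id}"
    using simple unfolding is_simple_def UG_simps by blast
  moreover have "K \<noteq> U"
    using moving unfolding K_def by blast
  moreover obtain u v where u: "u \<in> U" "u v = v" "u \<noteq> id"
    using U_nontrivial[of i] nontriv unfolding perm_nontrivial_def by (auto simp: BijGroup_def)
  then have "u \<in> K"
    using \<psi>[OF u(1), of _ v] by (simp add: K_def)
  ultimately show False
    using u(3) by blast
qed

lemma simple_UG:
  assumes trans: "perm_transitive (C j) (P j)" and nontriv: "perm_nontrivial (C i) (P i)"
    and gen: "\<And>i. gen_by_point_stabilisers (C i) (P i)"
  shows "is_simple UG"
proof -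
  obtain x y z where three: "x \<in> C i" "y \<in> C i" "z \<in> C i" "x \<noteq> y" "x \<noteq> z" "y \<noteq> z"
    using three_colours[OF gen nontriv] by blast
  obtain u v where "u \<in> U" "u \<noteq> id"
    using U_nontrivial[of i] nontriv unfolding perm_nontrivial_def by (auto simp: BijGroup_def)
  then have "carrier UG \<noteq> {\<one>\<^bsub>UG\<^esub>}"
    by (auto simp: UG_simps)
  moreover have "H = U \<or> H = {id}" if "H \<lhd> UG" for H
  proof -
    have H: "subgroup H UG"
      "\<And>u h. u \<in> carrier UG \<Longrightarrow> h \<in> H \<Longrightarrow> u \<otimes>\<^bsub>UG\<^esub> h \<otimes>\<^bsub>UG\<^esub> inv\<^bsub>UG\<^esub> u \<in> H"
      using that group.normal_inv_iff[OF group_UG] by auto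
    have sub: "H \<subseteq> U"
      using subgroup.subset[OF H(1)] by (simp add: UG_simps)
    interpret normal_part E side t C P H
    proof
      show "H \<subseteq> U" by (rule sub)
      show "id \<in> H"
        using subgroup.one_closed[OF H(1)] by (simp add: UG_simps)
      show "g \<circ> h \<in> H" if "g \<in> H" "h \<in> H" for g h
        using subgroup.m_closed[OF H(1) that] UG_simps(3)[OF subsetD[OF sub] subsetD[OF sub], OF that]
        by simp
      show "inv_perm g \<in> H" if "g \<in> H" for g
        using subgroup.m_inv_closed[OF H(1) that] UG_inv[OF subsetD[OF sub that]] by simp
      show "u \<circ> g \<circ> inv_perm u \<in> H" if u: "u \<in> U" and g: "g \<in> H" for u g
      proof -
        have "g \<in> U"
          using g sub by blast
        then show ?thesis
          using H(2)[of u g] u g by (simp add: UG_simps UG_inv U_comp U_inv)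
      qed
    qed
    show ?thesis
    proof (cases "H = {id}")
      case False
      then obtain f where f: "f \<in> H" "f \<noteq> id"
        using H_id by blast
      interpret full_normal_part E side t C P H
        by unfold_locales (use supports_in_H_all[OF trans f three] gen in auto)
      show ?thesis
        using H_eq_U[OF trans] by blast
    qed simp
  qed
  ultimately show ?thesis
    using group_UG unfolding is_simple_def UG_simps by blast
qed

section \<open>The action on one side of the bipartition\<close>

definition restricted :: "bool \<Rightarrow> ('v \<Rightarrow> 'v) monoid" where
  "restricted i = (BijGroup {v. side v = i})\<lparr>carrier := (\<lambda>g. restrict g {v. side v = i}) ` U\<rparr>"

lemma restrict_hom: "(\<lambda>g. restrict g {v. side v = i}) \<in> hom UG (BijGroup {v. side v = i})"
proof (rule homI)
  let ?V = "{v. side v = i}"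
  have Bij: "restrict g ?V \<in> Bij ?V" if "g \<in> U" for g
  proof -
    have "bij_betw g ?V ?V"
    proof (rule bij_betwI[of _ _ _ "inv_perm g"])
      show "inv_perm g \<in> ?V \<rightarrow> ?V"
        using U_side[OF U_inv[OF that]] by auto
    qed (use that U_side in auto)
    then show ?thesis
      by (simp add: Bij_def)
  qed
  show "restrict g ?V \<in> carrier (BijGroup ?V)" if "g \<in> carrier UG" for g
    using Bij that by (simp add: BijGroup_def UG_simps)
  show "restrict (g \<otimes>\<^bsub>UG\<^esub> h) ?V = restrict g ?V \<otimes>\<^bsub>BijGroup ?V\<^esub> restrict h ?V"
    if "g \<in> carrier UG" "h \<in> carrier UG" for g h
    using that Bij U_side by (auto simp: BijGroup_def UG_simps compose_def fun_eq_iff)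
qed

lemma group_restricted: "group (restricted i)"
proof -
  interpret group_hom UG "BijGroup {v. side v = i}" "\<lambda>g. restrict g {v. side v = i}"
    using group_UG group_BijGroup restrict_hom by (simp add: group_hom_def group_hom_axioms_def)
  show ?thesis
    using subgroup.subgroup_is_group[OF img_is_subgroup H.is_group]
    by (simp add: restricted_def UG_simps)
qed

text \<open>Faithfulness: if two elements agree on one side, their quotient fixes that side
  pointwise and is the identity by \<open>moved_vertex\<close>.\<close>

lemma restrict_iso: "(\<lambda>g. restrict g {v. side v = i}) \<in> iso UG (restricted i)"
proof -
  let ?V = "{v. side v = i}"
  have "g = h" if gh: "g \<in> U" "h \<in> U" and eq: "restrict g ?V = restrict h ?V" for g h
  proof (rule ccontr)
    assume "g \<noteq> h"
    let ?k = "inv_perm h \<circ> g"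
    have "?k \<noteq> id"
    proof
      assume "?k = id"
      then have "h (?k x) = h x" for x by simp
      then show False
        using gh(2) \<open>g \<noteq> h\<close> by (simp add: fun_eq_iff)
    qed
    then obtain v where v: "side v = i" "?k v \<noteq> v"
      using moved_vertex[OF U_comp[OF U_inv[OF gh(2)] gh(1)]] by blast
    have "g v = h v"
      using fun_cong[OF eq, of v] v(1) by simp
    with v(2) gh(2) show False by simp
  qed
  then have "inj_on (\<lambda>g. restrict g ?V) U"
    by (intro inj_onI)
  then show ?thesis
    using restrict_hom[of i]
    by (auto simp: iso_def hom_def restricted_def UG_simps bij_betw_def)
qed

lemma simple_restricted_iff: "is_simple (restricted i) \<longleftrightarrow> is_simple UG"
  using is_simple_iso[OF restrict_iso group_UG group_restricted]
    is_simple_iso[OF group.iso_set_sym[OF group_UG restrict_iso] group_restricted group_UG]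
  by blast

end

section \<open>Translation to legal colourings and the box product\<close>

theorem theorem4p5:
  fixes Xs Ys :: "'a set" and M N :: "('a \<Rightarrow> 'a) set"
    and E :: "'v \<Rightarrow> 'v \<Rightarrow> bool" and VX VY :: "'v set" and c :: "'v \<times> 'v \<Rightarrow> 'a"
  assumes "Xs \<inter> Ys = {}"
    and "\<exists>a b. a \<in> Xs \<and> b \<in> Xs \<and> a \<noteq> b"
    and "\<exists>a b. a \<in> Ys \<and> b \<in> Ys \<and> a \<noteq> b"
    and "perm_group Xs M" and "perm_group Ys N"
    and "gen_by_point_stabilisers Xs M" and "gen_by_point_stabilisers Ys N"
    and "perm_nontrivial Xs M \<or> perm_nontrivial Ys N"
    and "biregular_tree Xs Ys E VX VY"
    and "legal_colouring Xs Ys E VX VY c"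
  shows "is_simple (box_product Xs Ys E VX VY c M N) \<longleftrightarrow>
           perm_transitive Xs M \<or> perm_transitive Ys N"
proof -
  define side where "side v \<longleftrightarrow> v \<in> VX" for v
  \<comment> \<open>All arcs into \<open>v\<close> have the same colour, so the choice of
    \<open>u\<close> does not matter.\<close>
  define t where "t v = c (SOME u. E u v, v)" for v
  define C where "C i = (if i then Xs else Ys)" for i
  define P where "P i = (if i then M else N)" for i
  have tree: "is_tree E"
    using assms(9) by (simp add: biregular_tree_def)
  have parts: "VX \<inter> VY = {}" "VX \<union> VY = UNIV" "\<And>u v. E u v \<Longrightarrow> u \<in> VX \<longleftrightarrow> v \<in> VY"
    using assms(9) by (auto simp: biregular_tree_def)
  have VY: "v \<in> VY \<longleftrightarrow> \<not> side v" for v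
    using parts(1,2) by (auto simp: side_def)
  have t: "c (u, v) = t v" if "E u v" for u v
    using assms(10) someI[of "\<lambda>u. E u v", OF that] that unfolding legal_colouring_def t_def by blast
  have colours: "bij_betw t {w. E v w} (C (side v))" for v
  proof -
    have "bij_betw (\<lambda>w. c (v, w)) {w. E v w} (C (side v))"
      using assms(10) VY by (auto simp: legal_colouring_def C_def side_def)
    moreover have "bij_betw (\<lambda>w. c (v, w)) {w. E v w} (C (side v)) \<longleftrightarrow>
        bij_betw t {w. E v w} (C (side v))"
      by (rule bij_betw_cong) (simp add: t)
    ultimately show ?thesis by blast
  qed
  interpret coloured_tree E side t C P
  proof (intro coloured_tree.intro tree.intro coloured_tree_axioms.intro)
    show "is_tree E" by (rule tree)
    show "side v \<longleftrightarrow> \<not> side u" if "E u v" for u v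
      using parts(3)[OF that] VY by (simp add: side_def)
    show "bij_betw t {w. E v w} (C (side v))" for v by (rule colours)
    show "\<exists>a b. a \<in> C i \<and> b \<in> C i \<and> a \<noteq> b" for i
      using assms(2,3) by (cases i) (simp_all add: C_def)
    show "subgroup (P i) (BijGroup (C i))" for i
      using assms(4,5) by (cases i) (simp_all add: C_def P_def perm_group_def)
  qed
  \<comment> \<open>The colours of the neighbours of \<open>v\<close> exhaust
    \<open>C (side v)\<close> and both maps are extensional, so any witness \<sigma> equals the
    explicit local action.\<close>
  have loc: "local_action (C (side v)) E c g v \<in> P (side v) \<longleftrightarrow>
      (\<exists>\<sigma>\<in>P (side v). \<forall>w. E v w \<longrightarrow> t (g w) = \<sigma> (t w))" if g: "g \<in> tree_aut E" for g v
  proof -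
    have loc_colour: "local_action (C (side v)) E c g v (t w) = t (g w)" if w: "E v w" for w
    proof -
      have "(THE w'. E v w' \<and> c (v, w') = t w) = w"
        using w t colour_inj by (intro the_equality) auto
      moreover have "c (g v, g w) = t (g w)"
        using t[of "g v" "g w"] g w by (simp add: tree_aut_def)
      ultimately show ?thesis
        using colour_in[OF w] by (simp add: local_action_def)
    qed
    have "local_action (C (side v)) E c g v = \<sigma>"
      if \<sigma>: "\<sigma> \<in> P (side v)" "\<forall>w. E v w \<longrightarrow> t (g w) = \<sigma> (t w)" for \<sigma>
    proof (rule extensionalityI[of _ "C (side v)"])
      show "local_action (C (side v)) E c g v x = \<sigma> x" if "x \<in> C (side v)" for x
        using neighbour_of_colour[OF that] loc_colour \<sigma>(2) by metis
    qed (use P_ext[OF \<sigma>(1)] in \<open>simp_all add: local_action_def\<close>)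
    then show ?thesis
      using loc_colour by metis
  qed
  have "U_c Xs Ys E VX VY c M N = U"
  proof -
    have side: "g ` VX = VX \<longleftrightarrow> (\<forall>v. side (g v) = side v)" if "g \<in> tree_aut E" for g
    proof -
      have g: "bij g" using that by (simp add: tree_aut_def)
      show ?thesis
      proof
        assume "g ` VX = VX"
        then show "\<forall>v. side (g v) = side v"
          using g unfolding side_def by (metis bij_is_inj inj_image_mem_iff)
      next
        assume side: "\<forall>v. side (g v) = side v"
        show "g ` VX = VX"
        proof
          show "VX \<subseteq> g ` VX"
          proof
            fix v assume "v \<in> VX"
            obtain u where "v = g u"
              using g by (metis bij_pointE)
            then show "v \<in> g ` VX"
              using \<open>v \<in> VX\<close> side by (auto simp: side_def)
          qed
        qed (use side in \<open>auto simp: side_def\<close>)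
      qed
    qed
    have split: "(\<forall>v\<in>VX. local_action Xs E c g v \<in> M) \<and> (\<forall>v\<in>VY. local_action Ys E c g v \<in> N)
        \<longleftrightarrow> (\<forall>v. local_action (C (side v)) E c g v \<in> P (side v))" for g
      using VY by (auto simp: C_def P_def side_def)
    show ?thesis
      unfolding U_c_def U_def split by (intro Collect_cong conj_cong) (simp_all add: side loc)
  qed
  \<comment> \<open>The box product acts on \<open>VY\<close>, which is the side
    \<open>False\<close>.\<close>
  moreover have "{v. side v = False} = VY"
    using VY by auto
  ultimately have "box_product Xs Ys E VX VY c M N = restricted False"
    by (simp add: box_product_def restricted_def)
  then have "is_simple (box_product Xs Ys E VX VY c M N) \<longleftrightarrow> is_simple UG"
    using simple_restricted_iff by simp
  also have "\<dots> \<longleftrightarrow> (\<exists>j. perm_transitive (C j) (P j))"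
  proof -
    have gen: "gen_by_point_stabilisers (C i) (P i)" for i
      using assms(6,7) by (cases i) (simp_all add: C_def P_def)
    obtain i where "perm_nontrivial (C i) (P i)"
      using assms(8) by (metis C_def P_def)
    then show ?thesis
      using simple_UG[OF _ _ gen] not_simple_UG by blast
  qed
  also have "\<dots> \<longleftrightarrow> perm_transitive Xs M \<or> perm_transitive Ys N"
    by (auto simp: C_def P_def ex_bool_eq)
  finally show ?thesis .
qed

end
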